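(* For every real $p$ with $1<p<2$ and every integer $n\geq 2$, there exist $L_p$-zonotopes $A,B\subset\mathbb{R}^n$ and a unit vector $u\in\mathbb{S}^{n-1}$ for which the inequality $$\left(\frac{|A\oplus_p B|}{|P_{u^\perp}(A\oplus_p B)|}\right)^p\geq\left(\frac{|A|}{|P_{u^\perp}A|}\right)^p+\left(\frac{|B|}{|P_{u^\perp}B|}\right)^p$$ fails, that is, $$\left(\frac{|A\oplus_p B|}{|P_{u^\perp}(A\oplus_p B)|}\right)^p<\left(\frac{|A|}{|P_{u^\perp}A|}\right)^p+\left(\frac{|B|}{|P_{u^\perp}B|}\right)^p .$$
   Context: For a convex body $K\subset\mathbb{R}^n$, $h_K(x)=\max_{y\in K}\langle x,y\rangle$ denotes its support function. For $p\geq 1$ and convex bodies $K,L\subset\mathbb{R}^n$ containing the origin, the $L_p$-sum (Firey sum) $K\oplus_p L$ is the convex body defined by $h_{K\oplus_p L}^p(x)=h_K^p(x)+h_L^p(x)$ for all $x\in\mathbb{R}^n$. An $L_p$-zonotope is a finite $L_p$-sum of origin-symmetric segments $[-v,v]$, $v\in\mathbb{R}^n$. Here convex bodies are compact convex sets and may have empty interior. $P_{u^\perp}$ is the orthogonal projection onto the hyperplane $u^\perp$. $|A|$ denotes $n$-dimensional volume for $A\subset\mathbb{R}^n$, and $|P_{u^\perp}A|$ denotes $(n-1)$-dimensional volume in $u^\perp$. All three denominators are understood to be positive, so that the ratios are defined. *)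

theory Defs
  imports "HOL-Analysis.Analysis"
begin

definition convex_body :: "'a::euclidean_space set \<Rightarrow> bool" where
  "convex_body K \<longleftrightarrow> compact K \<and> convex K \<and> K \<noteq> {}"

definition support_fun :: "'a::euclidean_space set \<Rightarrow> 'a \<Rightarrow> real" where
  "support_fun K x = (SUP y\<in>K. x \<bullet> y)"

text \<open>The condition \<open>0 \<in> M\<close> says that the support function of \<open>M\<close> is nonnegative, as is
  implicit in taking its \<open>p\<close>-th power. It is needed for uniqueness: \<open>powr\<close> is a total function,
  whose values at negative bases carry no meaning.\<close>

definition Lp_sum :: "real \<Rightarrow> 'a::euclidean_space set \<Rightarrow> 'a set \<Rightarrow> 'a set" where
  "Lp_sum p K L = (THE M. convex_body M \<and> 0 \<in> M \<and>
     (\<forall>x. support_fun M x powr p = support_fun K x powr p + support_fun L x powr p))"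

text \<open>The segment \<open>[-0, 0]\<close> accounts for the empty sum.\<close>

inductive Lp_zonotope :: "real \<Rightarrow> 'a::euclidean_space set \<Rightarrow> bool" for p :: real where
  segment: "Lp_zonotope p (closed_segment (- v) v)"
| sum: "Lp_zonotope p Z \<Longrightarrow> Lp_zonotope p (Lp_sum p Z (closed_segment (- v) v))"

definition hyperplane_perp :: "'a::euclidean_space \<Rightarrow> 'a set" where
  "hyperplane_perp u = {x. u \<bullet> x = 0}"

definition proj_perp :: "'a::euclidean_space \<Rightarrow> 'a \<Rightarrow> 'a" where
  "proj_perp u x = x - ((u \<bullet> x) / (u \<bullet> u)) *\<^sub>R u"

definition orthonormal_basis_of :: "'a::euclidean_space set \<Rightarrow> 'a set \<Rightarrow> bool" where
  "orthonormal_basis_of S B \<longleftrightarrow>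
     B \<subseteq> S \<and> pairwise orthogonal B \<and> (\<forall>b\<in>B. norm b = 1) \<and> span B = S"

text \<open>Lebesgue measure of dimension \<open>dim S\<close> on a linear subspace \<open>S\<close>, built from an orthonormal
  basis of \<open>S\<close> exactly as \<open>lborel\<close> is built from \<open>Basis\<close>. By the rotation invariance of Lebesgue
  measure the choice of the basis is immaterial.\<close>

definition subspace_lborel :: "'a::euclidean_space set \<Rightarrow> 'a measure" where
  "subspace_lborel S = (let B = (SOME B. orthonormal_basis_of S B) in
     distr (\<Pi>\<^sub>M b\<in>B. (lborel :: real measure)) borel (\<lambda>f. \<Sum>b\<in>B. f b *\<^sub>R b))"

definition vol :: "'a::euclidean_space set \<Rightarrow> real" where
  "vol A = measure lborel A"

definition proj_vol :: "'a::euclidean_space \<Rightarrow> 'a set \<Rightarrow> real" where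
  "proj_vol u A = measure (subspace_lborel (hyperplane_perp u)) (proj_perp u ` A)"

end

theory Submission
  imports Defs
begin

text \<open>
  Let \<open>q\<close> be the exponent conjugate to \<open>p\<close>. By duality, the \<open>L\<^sub>p\<close>-sum of the segments \<open>[-v\<^sub>i, v\<^sub>i]\<close> is the
  image of the unit ball of \<open>l\<^sub>q\<close> under \<open>c \<mapsto> \<Sum> c\<^sub>i v\<^sub>i\<close> (\<open>lq_zonotope\<close>), and only the function
  \<open>x \<mapsto> \<Sum> \<bar>\<langle>x, v\<^sub>i\<rangle>\<bar>\<^sup>p\<close> of the generators matters. Write \<open>R Z\<close> for the \<open>p\<close>-th power of the ratio of
  \<open>Z\<close>, with \<open>u = e\<^sub>k\<close>. Fix \<open>j \<noteq> k\<close> and a small \<open>s > 0\<close>, and take as generators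

  \<^item> for \<open>A\<close>: \<open>e\<^sub>k + s e\<^sub>j\<close>, and \<open>(3/4)\<^sup>1\<^sup>/\<^sup>p e\<^sub>i\<close> for \<open>i \<noteq> k\<close>;
  \<^item> for \<open>B\<close>: \<open>e\<^sub>k\<close>, and \<open>(1/4)\<^sup>1\<^sup>/\<^sup>p e\<^sub>i\<close> for \<open>i \<noteq> k\<close>.

  Parallel generators merge, so the sum has the generators \<open>e\<^sub>k + s e\<^sub>j\<close>, \<open>e\<^sub>k\<close> and \<open>e\<^sub>i\<close> for \<open>i \<noteq> k\<close>.
  The projection along \<open>e\<^sub>k\<close> turns the tilted generator into \<open>s e\<^sub>j\<close>, which raises the weight of \<open>e\<^sub>j\<close> in
  the projection of \<open>A\<close> from \<open>3/4\<close> to \<open>3/4 + s\<^sup>p\<close>, and in that of the sum from \<open>1\<close> to \<open>1 + s\<^sup>p\<close>. The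
  volume of \<open>A\<close> does not depend on \<open>s\<close>, by a shear. With \<open>G = R B\<close> this gives

    \<open>R A + R B = G (3/4) / (3/4 + s\<^sup>p) + G = G (2 - (4/3) s\<^sup>p + \<dots>)\<close>,
    \<open>R (A \<oplus>\<^sub>p B) = 2 G V\<^sup>p / (1 + s\<^sup>p) = G V\<^sup>p (2 - 2 s\<^sup>p + \<dots>)\<close>,

  where \<open>V\<close> is the factor by which the tilt changes the volume of the sum. The inequality therefore
  fails for small \<open>s\<close> once \<open>V \<le> 1 + \<eta> s\<^sup>p\<close> is known for a small constant \<open>\<eta>\<close>.

  The volume is less sensitive to the tilt than the projection. A shear replaces the two generators
  by \<open>e\<^sub>k \<plusminus> \<sigma> e\<^sub>j\<close> with \<open>\<sigma> = s/2\<close>, which removes the effect of first order. Where \<open>\<bar>x\<^sub>k\<bar>\<close> is bounded below,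
  uniform convexity of the \<open>l\<^sub>q\<close> ball leaves an effect of order \<open>\<sigma>\<^sup>2\<close> (\<open>balanced_map_outer\<close>),
  which is negligible against \<open>\<sigma>\<^sup>p\<close> because \<open>p < 2\<close>. In a slab \<open>\<bar>x\<^sub>k\<bar> \<le> h\<close> the effect is of order \<open>\<sigma>\<^sup>p\<close>
  (\<open>balanced_map_inner\<close>), but the slab carries only a multiple of \<open>h\<close> of the volume, and \<open>h\<close> can be
  chosen first. Adding up gives \<open>measure_balanced_image_le\<close>.

  The volume of a projection is defined through some orthonormal basis of the hyperplane. It is
  traded for the \<open>n\<close>-dimensional volume of a cylinder of height one over the projection
  (\<open>proj_vol_eq_vol_cylinder\<close>), so that all volumes are compared by linear maps of the whole space.
\<close>

section \<open>Lebesgue measure under linear maps\<close>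

text \<open>Every linear map is a product of elementary ones, each of which multiplies Lebesgue measure by a
  constant. The value of the constant is left open: for the maps used below it can be
  read off from a single set.\<close>

lemma linear_image_scales_measure:
  fixes f :: "real^'n \<Rightarrow> real^'n"
  assumes "linear f"
  shows "\<exists>m. \<forall>S\<in>lmeasurable. f ` S \<in> lmeasurable \<and> measure lebesgue (f ` S) = m * measure lebesgue S"
    (is "?scales f")
proof (rule induct_linear_elementary[OF assms, where P = ?scales])
  fix f g :: "real^'n \<Rightarrow> real^'n"
  assume "?scales f" "?scales g"
  then obtain a b where
    "\<forall>S\<in>lmeasurable. f ` S \<in> lmeasurable \<and> measure lebesgue (f ` S) = a * measure lebesgue S"
    "\<forall>S\<in>lmeasurable. g ` S \<in> lmeasurable \<and> measure lebesgue (g ` S) = b * measure lebesgue S"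
    by blast
  then have "\<forall>S\<in>lmeasurable. f ` g ` S \<in> lmeasurable \<and>
      measure lebesgue (f ` g ` S) = a * b * measure lebesgue S"
    by simp
  then show "?scales (f \<circ> g)"
    unfolding image_comp by blast
next
  fix f :: "real^'n \<Rightarrow> real^'n" and i
  assume f: "linear f" "\<And>x. f x $ i = 0"
  then have "\<not> inj f"
    by (metis linear_injective_imp_surjective one_neq_zero surjE vec_component)
  then have "negligible (f ` S)" for S
    using f negligible_linear_singular_image by blast
  then show "?scales f"
    by (intro exI[of _ 0]) (simp add: negligible_iff_measure)
next
  show "?scales (\<lambda>x. \<chi> i. c i * x $ i)" for c
    using measurable_stretch[of _ c] measure_stretch[of _ c] by blast
next
  fix m n :: 'n
  let ?f = "\<lambda>x :: real^'n. \<chi> i. x $ Transposition.transpose m n i"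
  have lin: "linear ?f"
    by (rule linearI) (simp_all add: vec_eq_iff)
  have meq: "measure lebesgue (?f ` cbox a b) = 1 * measure lebesgue (cbox a b)" for a b
  proof (cases "cbox a b = {}")
    case False
    have eq: "?f ` cbox a b = cbox (?f a) (?f b)"
      by (auto simp: image_iff lambda_swap_Galois mem_box_cart) (metis transpose_involutory)+
    with False have "cbox (?f a) (?f b) \<noteq> {}"
      by blast
    then show ?thesis
      using False prod.permute[OF permutes_swap_id, where S = UNIV and g = "\<lambda>i. (b - a) $ i", of m n]
      by (simp add: eq content_cbox_cart)
  qed simp
  have "?f ` S \<in> lmeasurable" "measure lebesgue (?f ` S) = 1 * measure lebesgue S"
    if "S \<in> lmeasurable" for S
    using measure_linear_sufficient[OF lin that meq] by simp_all
  then show "?scales ?f"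
    by blast
next
  fix m n :: 'n
  assume "m \<noteq> n"
  let ?f = "\<lambda>x :: real^'n. \<chi> i. if i = m then x $ m + x $ n else x $ i"
  have lin: "linear ?f"
    by (rule linearI) (auto simp: vec_eq_iff algebra_simps)
  have meq: "measure lebesgue (?f ` cbox a b) = 1 * measure lebesgue (cbox a b)" for a b
  proof (cases "cbox a b = {}")
    case False
    define v where "v = axis n (- a $ n)"
    have "(+) (?f v) ` ?f ` cbox a b = ?f ` cbox (v + a) (v + b)"
      by (simp add: image_comp o_def linear_add[OF lin, symmetric] cbox_translation)
    then have "measure lebesgue (?f ` cbox a b) = measure lebesgue (?f ` cbox (v + a) (v + b))"
      using measure_translation[of "?f v" "?f ` cbox a b"] by (simp only:)
    also have "\<dots> = measure lebesgue (cbox (v + a) (v + b))"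
      using False \<open>m \<noteq> n\<close>
      by (intro measure_shear_interval) (auto simp: v_def cbox_translation)
    also have "\<dots> = measure lebesgue (cbox a b)"
      by (simp only: cbox_translation measure_translation)
    finally show ?thesis by simp
  qed simp
  have "?f ` S \<in> lmeasurable" "measure lebesgue (?f ` S) = 1 * measure lebesgue S"
    if "S \<in> lmeasurable" for S
    using measure_linear_sufficient[OF lin that meq] by simp_all
  then show "?scales ?f"
    by blast
qed

text \<open>The unit ball is mapped onto itself, so the scaling constant is \<open>1\<close>.\<close>

lemma measure_orthogonal_image_cart:
  fixes f :: "real^'n \<Rightarrow> real^'n"
  assumes f: "orthogonal_transformation f" and S: "S \<in> lmeasurable"
  shows "measure lebesgue (f ` S) = measure lebesgue S"
proof -
  obtain m where m: "\<And>S. S \<in> lmeasurable \<Longrightarrow> measure lebesgue (f ` S) = m * measure lebesgue S"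
    using linear_image_scales_measure f orthogonal_transformation_linear by blast
  have "f ` ball 0 1 = ball 0 1"
    using image_orthogonal_transformation_ball[OF f, of 0 1]
      linear_0[OF orthogonal_transformation_linear[OF f]] by simp
  moreover have "measure lebesgue (ball (0 :: real^'n) 1) > 0"
    by (simp add: content_ball_pos)
  ultimately have "m = 1"
    using m[of "ball 0 1"] by simp
  then show ?thesis
    using m S by simp
qed

definition stretch :: "('n \<Rightarrow> real) \<Rightarrow> real^'n \<Rightarrow> real^'n" where
  "stretch m x = (\<chi> i. m i * x $ i)"

lemma linear_stretch: "linear (stretch m)"
  by (rule linearI) (simp_all add: stretch_def vec_eq_iff algebra_simps)

lemma stretch_0: "stretch m 0 = 0"
  by (rule linear_0[OF linear_stretch])

lemma stretch_axis: "stretch m (axis i 1) = m i *\<^sub>R axis i 1"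
  by (simp add: stretch_def vec_eq_iff axis_def)

lemma measure_stretch_image:
  assumes "S \<in> lmeasurable"
  shows "stretch m ` S \<in> lmeasurable"
    and "measure lebesgue (stretch m ` S) = \<bar>prod m UNIV\<bar> * measure lebesgue S"
  using measurable_stretch[OF assms, of m] measure_stretch[OF assms, of m]
  by (simp_all add: stretch_def[abs_def])

definition shear :: "'n \<Rightarrow> 'n \<Rightarrow> real \<Rightarrow> real^'n \<Rightarrow> real^'n" where
  "shear j k c x = x + axis j (c * x $ k)"

lemma linear_shear: "linear (shear j k c)"
  by (rule linearI) (auto simp: shear_def vec_eq_iff axis_def algebra_simps)

lemma shear_shear: "j \<noteq> k \<Longrightarrow> shear j k c (shear j k d x) = shear j k (c + d) x"
  by (auto simp: shear_def vec_eq_iff axis_def algebra_simps)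

lemma shear_0: "shear j k 0 x = x"
  by (auto simp: shear_def vec_eq_iff axis_def)

text \<open>Conjugating a shear by the dilation that doubles the coordinate \<open>k\<close> squares it. Hence its scaling
  constant satisfies \<open>m\<^sup>2 = m\<close>, and \<open>m \<noteq> 0\<close> because the shear is invertible.\<close>

lemma measure_shear_image:
  fixes S :: "(real^'n) set"
  assumes "j \<noteq> k" and S: "S \<in> lmeasurable"
  shows "measure lebesgue (shear j k c ` S) = measure lebesgue S"
proof -
  define D :: "real^'n \<Rightarrow> real^'n" where "D = stretch (\<lambda>i. if i = k then 2 else 1)"
  have D: "D ` S \<in> lmeasurable" "measure lebesgue (D ` S) = 2 * measure lebesgue S"
    if "S \<in> lmeasurable" for S
    using measure_stretch_image[OF that, of "\<lambda>i. if i = k then 2 else 1"]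
    by (simp_all add: D_def)
  obtain m where m: "\<And>S. S \<in> lmeasurable \<Longrightarrow> shear j k c ` S \<in> lmeasurable"
      "\<And>S. S \<in> lmeasurable \<Longrightarrow> measure lebesgue (shear j k c ` S) = m * measure lebesgue S"
    using linear_image_scales_measure[OF linear_shear] by metis
  let ?B = "ball (0 :: real^'n) 1"
  have pos: "measure lebesgue ?B > 0"
    by (simp add: content_ball_pos)
  have "D (shear j k (2 * c) x) = shear j k c (D x)" for x
    using \<open>j \<noteq> k\<close> by (auto simp: D_def stretch_def shear_def vec_eq_iff axis_def)
  then have "D ` shear j k (2 * c) ` ?B = shear j k c ` D ` ?B"
    by (simp add: image_image)
  moreover have "shear j k (2 * c) ` ?B = shear j k c ` shear j k c ` ?B"
    using \<open>j \<noteq> k\<close> by (simp add: image_image shear_shear)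
  ultimately have "measure lebesgue (D ` shear j k c ` shear j k c ` ?B)
      = measure lebesgue (shear j k c ` D ` ?B)"
    by simp
  then have "2 * (m * (m * measure lebesgue ?B)) = m * (2 * measure lebesgue ?B)"
    by (simp only: D m lmeasurable_ball)
  then have "m = 0 \<or> m = 1"
    using pos by simp
  moreover have "m \<noteq> 0"
  proof
    assume "m = 0"
    moreover have "shear j k c ` shear j k (- c) ` ?B = ?B"
      using \<open>j \<noteq> k\<close> by (simp add: image_image shear_shear shear_0)
    moreover have "shear j k (- c) ` ?B \<in> lmeasurable"
      using linear_image_scales_measure[OF linear_shear] lmeasurable_ball by blast
    ultimately show False
      using m(2) pos by (metis less_irrefl mult_zero_left)
  qed
  ultimately show ?thesis
    using m(2) S by simp
qed

section \<open>Volume of projections\<close>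

text \<open>Lebesgue measure can be built from any orthonormal basis \<open>B\<close>, not just from the standard one: a
  bijection \<open>g\<close> from \<open>B\<close> to the standard basis extends to an orthogonal map \<open>T\<close>, which turns
  the measure built from \<open>B\<close> into the standard one and preserves the latter.\<close>

lemma orthonormal_basis_measure:
  fixes B C :: "(real^'n) set"
  assumes orth: "pairwise orthogonal B" and unit: "\<And>b. b \<in> B \<Longrightarrow> norm b = 1"
    and span: "span B = UNIV" and C: "compact C"
  shows "measure (distr (\<Pi>\<^sub>M b\<in>B. (lborel :: real measure)) borel (\<lambda>f. \<Sum>b\<in>B. f b *\<^sub>R b)) C
    = measure lborel C"
proof -
  have indep: "independent B"
    using unit by (intro pairwise_orthogonal_independent[OF orth]) force
  then have fin: "finite B"
    using independent_bound by blast
  have "card B = card (Basis :: (real^'n) set)"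
    using dim_span_eq_card_independent[OF indep] by (simp add: span)
  with finite_same_card_bij[OF fin finite_Basis] obtain g where g: "bij_betw g B (Basis :: (real^'n) set)"
    by metis
  define T :: "real^'n \<Rightarrow> real^'n" where "T x = (\<Sum>b\<in>B. (x \<bullet> b) *\<^sub>R g b)" for x
  have expand: "(\<Sum>b\<in>B. (x \<bullet> b) *\<^sub>R b) = x" for x
    using orthonormal_basis_expand[OF orth unit _ fin] span by auto
  have inner_g: "g a \<bullet> g b = (if b = a then 1 else 0)" if "a \<in> B" "b \<in> B" for a b
  proof -
    have "g a \<in> Basis" "g b \<in> Basis" "g a = g b \<longleftrightarrow> b = a"
      using that g by (auto dest: bij_betwE bij_betw_imp_inj_on inj_onD)
    then show ?thesis
      by (simp add: inner_Basis)
  qed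
  have inner_B: "a \<bullet> b = (if b = a then 1 else 0)" if "a \<in> B" "b \<in> B" for a b
  proof (cases "a = b")
    case True
    then show ?thesis
      using unit[OF \<open>a \<in> B\<close>] by (simp add: dot_square_norm)
  next
    case False
    then show ?thesis
      using orth that unfolding pairwise_def orthogonal_def by auto
  qed
  have coord: "(\<Sum>b\<in>B. f b *\<^sub>R h b) \<bullet> h a = f a"
    if "a \<in> B" "\<And>a b. a \<in> B \<Longrightarrow> b \<in> B \<Longrightarrow> h a \<bullet> h b = (if b = a then 1 else 0)"
    for f a and h :: "real^'n \<Rightarrow> real^'n"
  proof -
    have "(\<Sum>b\<in>B. f b *\<^sub>R h b) \<bullet> h a = (\<Sum>b\<in>B. if a = b then f b else 0)"
      unfolding inner_sum_left using that by (intro sum.cong refl) simp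
    then show ?thesis
      using that(1) fin by simp
  qed
  have T: "orthogonal_transformation T"
    unfolding orthogonal_transformation_def
  proof safe
    show "linear T"
      unfolding T_def by (rule linearI) (simp_all add: inner_add_left scaleR_add_left sum.distrib scaleR_sum_right)
    fix x y
    have "T x \<bullet> T y = (\<Sum>a\<in>B. (x \<bullet> a) * (T y \<bullet> g a))"
      unfolding T_def[of x] inner_sum_left by (simp add: inner_commute)
    also have "\<dots> = (\<Sum>a\<in>B. (x \<bullet> a) * (y \<bullet> a))"
      unfolding T_def[of y] using coord[of _ g] inner_g by (intro sum.cong refl) simp
    also have "\<dots> = (\<Sum>a\<in>B. (x \<bullet> a) *\<^sub>R a) \<bullet> y"
      unfolding inner_sum_left by (simp add: inner_commute)
    finally show "T x \<bullet> T y = x \<bullet> y"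
      by (simp only: expand)
  qed
  have Tf: "T (\<Sum>b\<in>B. f b *\<^sub>R b) = (\<Sum>b\<in>B. f b *\<^sub>R g b)" for f
  proof -
    have "(\<Sum>b\<in>B. f b *\<^sub>R b) \<bullet> a = f a" if "a \<in> B" for a
      using coord[of a "\<lambda>b. b" f] that inner_B by simp
    then show ?thesis
      unfolding T_def by (intro sum.cong refl) simp
  qed
  interpret product_sigma_finite "\<lambda>_ :: real^'n. lborel :: real measure"
    by standard
  let ?P = "\<Pi>\<^sub>M b\<in>B. (lborel :: real measure)"
  have meas[measurable]: "(\<lambda>f. \<Sum>b\<in>B. f b *\<^sub>R h b) \<in> borel_measurable ?P" for h :: "real^'n \<Rightarrow> real^'n"
    by measurable
  have lborel_g: "lborel = distr ?P borel (\<lambda>f. \<Sum>b\<in>B. f b *\<^sub>R g b)"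
  proof (rule lborel_eqI)
    fix l u :: "real^'n"
    assume le: "\<And>b. b \<in> Basis \<Longrightarrow> l \<bullet> b \<le> u \<bullet> b"
    have coord_g: "(\<Sum>b\<in>B. f b *\<^sub>R g b) \<bullet> g a = f a" if "a \<in> B" for f a
      using coord[of a g f] that inner_g by simp
    have "(\<lambda>f. \<Sum>b\<in>B. f b *\<^sub>R g b) -` box l u \<inter> space ?P = (\<Pi>\<^sub>E b\<in>B. {l \<bullet> g b<..<u \<bullet> g b})"
    proof -
      have g_image: "g ` B = Basis"
        using g by (simp add: bij_betw_def)
      have "y \<in> box l u \<longleftrightarrow> (\<forall>b\<in>B. l \<bullet> g b < y \<bullet> g b \<and> y \<bullet> g b < u \<bullet> g b)" for y
        by (simp add: box_def flip: g_image)
      then show ?thesis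
        by (auto simp: space_PiM PiE_iff coord_g)
    qed
    then have "emeasure (distr ?P borel (\<lambda>f. \<Sum>b\<in>B. f b *\<^sub>R g b)) (box l u)
        = emeasure ?P (\<Pi>\<^sub>E b\<in>B. {l \<bullet> g b<..<u \<bullet> g b})"
      by (simp add: emeasure_distr)
    also have "\<dots> = (\<Prod>b\<in>B. ennreal ((u - l) \<bullet> g b))"
      using fin le bij_betwE[OF g]
      by (subst emeasure_PiM) (auto simp: inner_diff_left intro!: prod.cong emeasure_lborel_Ioo)
    also have "\<dots> = (\<Prod>b\<in>Basis. ennreal ((u - l) \<bullet> b))"
      by (rule prod.reindex_bij_betw[OF g])
    finally show "emeasure (distr ?P borel (\<lambda>f. \<Sum>b\<in>B. f b *\<^sub>R g b)) (box l u)
        = ennreal (\<Prod>b\<in>Basis. (u - l) \<bullet> b)"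
      using le by (simp add: prod_ennreal inner_diff_left)
  qed simp
  have compact_TC: "compact (T ` C)"
    using T C by (intro compact_continuous_image linear_continuous_on)
      (auto simp: linear_conv_bounded_linear[symmetric] orthogonal_transformation_linear)
  then have [measurable]: "T ` C \<in> sets borel" "C \<in> sets borel"
    using C by (auto intro: borel_compact)
  have "measure lborel (T ` C)
      = measure ?P ((\<lambda>f. \<Sum>b\<in>B. f b *\<^sub>R g b) -` (T ` C) \<inter> space ?P)"
    by (subst lborel_g) (simp add: measure_distr)
  also have "(\<lambda>f. \<Sum>b\<in>B. f b *\<^sub>R g b) -` (T ` C) = (\<lambda>f. \<Sum>b\<in>B. f b *\<^sub>R b) -` C"
    using orthogonal_transformation_inj[OF T] by (auto simp: Tf[symmetric] inj_eq)
  also have "measure ?P (\<dots> \<inter> space ?P)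
      = measure (distr ?P borel (\<lambda>f. \<Sum>b\<in>B. f b *\<^sub>R b)) C"
    by (simp add: measure_distr)
  finally show ?thesis
    using measure_orthogonal_image_cart[OF T, of C] C compact_TC
    by (simp add: lmeasurable_compact borel_compact)
qed

definition unit_cylinder :: "'a::euclidean_space \<Rightarrow> 'a set \<Rightarrow> 'a set" where
  "unit_cylinder u Y = (\<lambda>(y, r). y + r *\<^sub>R u) ` (Y \<times> {0..1})"

lemma mem_unit_cylinder: "z \<in> unit_cylinder u Y \<longleftrightarrow> (\<exists>y\<in>Y. \<exists>r\<in>{0..1}. z = y + r *\<^sub>R u)"
  by (auto simp: unit_cylinder_def)

lemma compact_unit_cylinder: "compact Y \<Longrightarrow> compact (unit_cylinder u Y)"
  unfolding unit_cylinder_def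
  by (intro compact_continuous_image compact_Times continuous_intros)
     (auto simp: case_prod_beta intro!: continuous_intros)

lemma continuous_on_proj_perp: "continuous_on S (proj_perp u)"
  unfolding proj_perp_def divide_inverse by (intro continuous_intros)

text \<open>Adding \<open>u\<close> to an orthonormal basis of the hyperplane gives one of the whole space, and Fubini
  integrates out the coordinate along \<open>u\<close>, in which the cylinder has length \<open>1\<close>.\<close>

lemma proj_vol_eq_vol_cylinder:
  fixes X :: "(real^'n) set"
  assumes u: "norm u = 1" and X: "compact X"
  shows "proj_vol u X = vol (unit_cylinder u (proj_perp u ` X))"
proof -
  let ?S = "hyperplane_perp u" and ?Y = "proj_perp u ` X"
  have uu: "u \<bullet> u = 1"
    using u by (simp add: dot_square_norm)
  have "\<exists>B. orthonormal_basis_of ?S B"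
    unfolding orthonormal_basis_of_def hyperplane_perp_def
    by (rule orthonormal_basis_subspace[OF subspace_hyperplane[of u]]) blast
  then obtain B where B: "orthonormal_basis_of ?S B" "B = (SOME B. orthonormal_basis_of ?S B)"
    by (metis someI_ex)
  then have BS: "\<And>b. b \<in> B \<Longrightarrow> u \<bullet> b = 0" and orth: "pairwise orthogonal B"
    and unit: "\<And>b. b \<in> B \<Longrightarrow> norm b = 1" and span: "span B = ?S"
    by (auto simp: orthonormal_basis_of_def hyperplane_perp_def)
  have "independent B"
    using orth unit by (intro pairwise_orthogonal_independent) force+
  then have fin: "finite B"
    using independent_bound by blast
  have uB: "u \<notin> B"
    using BS uu by force
  have YS: "u \<bullet> y = 0" if "y \<in> ?Y" for y
    using that uu by (auto simp: proj_perp_def inner_diff_right)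
  have "x \<in> span (insert u B)" for x
  proof -
    have "x - (u \<bullet> x) *\<^sub>R u \<in> span B"
      using uu by (simp add: span hyperplane_perp_def inner_diff_right)
    then show ?thesis
      using span_insert by blast
  qed
  then have span': "span (insert u B) = UNIV"
    by auto
  have orth': "pairwise orthogonal (insert u B)"
    using orth BS by (auto simp: pairwise_insert orthogonal_def inner_commute)
  let ?C = "unit_cylinder u ?Y"
  have Y: "compact ?Y"
    using X by (intro compact_continuous_image continuous_on_proj_perp)
  then have C: "compact ?C"
    by (rule compact_unit_cylinder)
  have [measurable]: "?Y \<in> sets borel" "?C \<in> sets borel"
    using Y C by (auto intro: borel_compact)
  interpret product_sigma_finite "\<lambda>_ :: real^'n. lborel :: real measure"
    by standard
  let ?P = "\<lambda>B :: (real^'n) set. \<Pi>\<^sub>M b\<in>B. (lborel :: real measure)"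
  let ?s = "\<lambda>(B :: (real^'n) set) f. \<Sum>b\<in>B. f b *\<^sub>R b"
  have s[measurable]: "?s A \<in> borel_measurable (?P A)" for A
    by measurable
  have split: "?s (insert u B) (x(u := r)) \<in> ?C \<longleftrightarrow> ?s B x \<in> ?Y \<and> r \<in> {0..1}" for x r
  proof -
    have sum_eq: "?s (insert u B) (x(u := r)) = r *\<^sub>R u + ?s B x"
      using fin uB by (simp add: sum.insert) (intro sum.cong, auto)
    have perp: "u \<bullet> ?s B x = 0"
      using BS by (simp add: inner_sum_right)
    \<comment> \<open>The coordinate along \<open>u\<close> and the component in the hyperplane are determined by the point.\<close>
    have "r *\<^sub>R u + ?s B x \<in> ?C" if "?s B x \<in> ?Y" "r \<in> {0..1}"
      using that unfolding mem_unit_cylinder by (intro bexI[of _ "?s B x"] bexI[of _ r]) auto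
    moreover have "?s B x \<in> ?Y \<and> r \<in> {0..1}" if "r *\<^sub>R u + ?s B x \<in> ?C"
    proof -
      have "\<exists>y\<in>?Y. \<exists>r'\<in>{0..1}. r *\<^sub>R u + ?s B x = y + r' *\<^sub>R u"
        using that by (simp only: mem_unit_cylinder)
      then obtain y r' where y: "y \<in> ?Y" and r': "r' \<in> {0..1}"
        and eq: "r *\<^sub>R u + ?s B x = y + r' *\<^sub>R u"
        by (elim bexE)
      have "u \<bullet> (r *\<^sub>R u + ?s B x) = r" "u \<bullet> (y + r' *\<^sub>R u) = r'"
        using perp YS[OF y] uu by (simp_all add: inner_add_right)
      then have "r = r'"
        using eq by simp
      with eq y r' show ?thesis
        by simp
    qed
    ultimately show ?thesis
      unfolding sum_eq by blast
  qed
  have "emeasure (distr (?P (insert u B)) borel (?s (insert u B))) ?C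
      = (\<integral>\<^sup>+f. indicator ?C (?s (insert u B) f) \<partial>?P (insert u B))"
    by (subst nn_integral_indicator[symmetric], simp, subst nn_integral_distr) simp_all
  also have "\<dots> = (\<integral>\<^sup>+x. \<integral>\<^sup>+r. indicator ?C (?s (insert u B) (x(u := r))) \<partial>lborel \<partial>?P B)"
    using fin uB by (intro product_nn_integral_insert) simp_all
  also have "\<dots> = (\<integral>\<^sup>+x. \<integral>\<^sup>+r. (indicator ?Y (?s B x) :: ennreal) * indicator {0..1::real} r \<partial>lborel \<partial>?P B)"
    by (intro nn_integral_cong) (simp add: indicator_def split of_bool_conj del: fun_upd_apply)
  also have "\<dots> = (\<integral>\<^sup>+x. indicator ?Y (?s B x) \<partial>?P B)"
    by (simp add: nn_integral_cmult)
  also have "\<dots> = emeasure (distr (?P B) borel (?s B)) ?Y"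
    by (subst nn_integral_indicator[symmetric], simp, subst nn_integral_distr) simp_all
  finally have "measure (distr (?P (insert u B)) borel (?s (insert u B))) ?C
      = measure (distr (?P B) borel (?s B)) ?Y"
    by (simp add: measure_def)
  moreover have "measure (distr (?P (insert u B)) borel (?s (insert u B))) ?C = measure lborel ?C"
    using unit u by (intro orthonormal_basis_measure[OF orth' _ span' C]) auto
  ultimately show ?thesis
    by (simp add: proj_vol_def subspace_lborel_def vol_def B(2)[symmetric] Let_def)
qed

section \<open>Uniqueness of the \<open>L\<^sub>p\<close>-sum\<close>

text \<open>A point outside a convex body is strictly separated from it, and the support functions differ in
  the direction of separation.\<close>

lemma convex_body_eqI:
  fixes M N :: "'a::euclidean_space set"
  assumes "convex_body M" "convex_body N" and eq: "\<And>x. support_fun M x = support_fun N x"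
  shows "M = N"
proof -
  have sub: "M \<subseteq> N" if M: "convex_body M" and N: "convex_body N"
    and eq: "\<And>x. support_fun M x = support_fun N x" for M N :: "'a set"
  proof
    fix z assume "z \<in> M"
    show "z \<in> N"
    proof (rule ccontr)
      assume "z \<notin> N"
      then obtain a b where ab: "a \<bullet> z < b" "\<And>x. x \<in> N \<Longrightarrow> a \<bullet> x > b"
        using separating_hyperplane_closed_point[of N z] N
        by (auto simp: convex_body_def compact_imp_closed)
      have "bounded ((\<bullet>) (- a) ` M)"
        using M by (intro compact_imp_bounded compact_continuous_image continuous_intros)
          (auto simp: convex_body_def)
      then have "- a \<bullet> z \<le> support_fun M (- a)"
        unfolding support_fun_def using \<open>z \<in> M\<close>
        by (intro cSUP_upper bounded_imp_bdd_above)
      also have "support_fun M (- a) \<le> - b"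
        unfolding eq unfolding support_fun_def using N ab(2)
        by (intro cSUP_least) (auto simp: convex_body_def less_imp_le)
      finally show False
        using ab(1) by simp
    qed
  qed
  show ?thesis
    using sub[OF assms(1,2) eq] sub[OF assms(2,1) eq[symmetric]] by blast
qed

lemma support_fun_nonneg:
  fixes M :: "'a::euclidean_space set"
  assumes "convex_body M" "0 \<in> M"
  shows "0 \<le> support_fun M x"
proof -
  have "bounded ((\<bullet>) x ` M)"
    using assms by (intro compact_imp_bounded compact_continuous_image continuous_intros)
      (auto simp: convex_body_def)
  then have "x \<bullet> 0 \<le> support_fun M x"
    unfolding support_fun_def using assms(2)
    by (intro cSUP_upper bounded_imp_bdd_above)
  then show ?thesis by simp
qed

lemma Lp_sum_eqI:
  fixes M :: "'a::euclidean_space set"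
  assumes p: "p > 0" and M: "convex_body M" "0 \<in> M"
    and supp: "\<And>x. support_fun M x powr p = support_fun K x powr p + support_fun L x powr p"
  shows "Lp_sum p K L = M"
  unfolding Lp_sum_def
proof (rule the_equality)
  fix N :: "'a set"
  assume N: "convex_body N \<and> 0 \<in> N \<and>
    (\<forall>x. support_fun N x powr p = support_fun K x powr p + support_fun L x powr p)"
  have "support_fun N x = support_fun M x" for x
  proof -
    have "support_fun N x powr p = support_fun M x powr p"
      using N supp by simp
    moreover have "0 \<le> support_fun N x" "0 \<le> support_fun M x"
      using N M by (auto intro: support_fun_nonneg)
    moreover have "(a powr p) powr (1 / p) = a" if "a \<ge> 0" for a
      using that p by (simp add: powr_powr)
    ultimately show ?thesis
      by metis
  qed
  then show "N = M"
    using N M convex_body_eqI by blast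
qed (use assms in blast)

section \<open>\<open>L\<^sub>p\<close>-zonotopes as linear images of the \<open>l\<^sub>q\<close> ball\<close>

text \<open>The triangle inequality reduces the claim to the half-line, where the second derivative is
  nonnegative; at the origin it amounts to \<open>a\<^sup>q \<le> a\<close> for \<open>0 \<le> a \<le> 1\<close>.\<close>

lemma convex_powr_abs:
  fixes x y :: real
  assumes q: "q \<ge> 1" and ab: "a \<ge> 0" "b \<ge> 0" "a + b = 1"
  shows "\<bar>a * x + b * y\<bar> powr q \<le> a * \<bar>x\<bar> powr q + b * \<bar>y\<bar> powr q"
proof -
  have nonneg: "(a * x + b * y) powr q \<le> a * x powr q + b * y powr q"
    if xy: "x \<ge> 0" "y \<ge> 0" for x y
  proof -
    have le: "(c * z) powr q \<le> c * z powr q" if "0 \<le> c" "c \<le> 1" for c z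
    proof (cases "c = 0")
      case False
      have "c powr q \<le> c powr 1"
        using that q False by (intro powr_mono') auto
      then show ?thesis
        using that by (simp add: powr_mult mult_right_mono)
    qed simp
    consider "x = 0" | "y = 0" | "x > 0" "y > 0"
      using xy by linarith
    then show ?thesis
    proof cases
      case 3
      then show ?thesis
        using powr_convex[OF q] ab unfolding convex_on_def by auto
    qed (use le ab in auto)
  qed
  have "\<bar>a * x + b * y\<bar> powr q \<le> (a * \<bar>x\<bar> + b * \<bar>y\<bar>) powr q"
    using ab q by (intro powr_mono2) (auto simp: abs_mult intro: order_trans[OF abs_triangle_ineq])
  also have "\<dots> \<le> a * \<bar>x\<bar> powr q + b * \<bar>y\<bar> powr q"
    by (rule nonneg) auto
  finally show ?thesis .
qed

definition lq_ball :: "real \<Rightarrow> (real^'i) set" where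
  "lq_ball q = {c. (\<Sum>i\<in>UNIV. \<bar>c $ i\<bar> powr q) \<le> 1}"

text \<open>By duality this is the \<open>L\<^sub>p\<close>-sum of the segments \<open>[-v\<^sub>i, v\<^sub>i]\<close> for the exponent \<open>p\<close> conjugate to \<open>q\<close>.
  The generators may vanish, so that a subfamily is expressed over the same index type.\<close>

definition lq_zonotope :: "real \<Rightarrow> ('i::finite \<Rightarrow> 'a::euclidean_space) \<Rightarrow> 'a set" where
  "lq_zonotope q v = (\<lambda>c. \<Sum>i\<in>UNIV. c $ i *\<^sub>R v i) ` (lq_ball q :: (real^'i) set)"

lemma lq_ball_component_le:
  assumes "q > 0" "c \<in> lq_ball q"
  shows "\<bar>c $ i\<bar> \<le> 1"
proof -
  have "\<bar>c $ i\<bar> powr q \<le> (\<Sum>i\<in>UNIV. \<bar>c $ i\<bar> powr q)"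
    by (intro member_le_sum) auto
  also have "\<dots> \<le> 1"
    using assms by (simp add: lq_ball_def)
  finally have "\<bar>c $ i\<bar> powr q \<le> 1" .
  moreover have "1 powr q < \<bar>c $ i\<bar> powr q" if "1 < \<bar>c $ i\<bar>"
    using that assms(1) by (intro powr_less_mono2) auto
  ultimately show ?thesis
    by force
qed

lemma compact_lq_ball:
  assumes q: "q > 0"
  shows "compact (lq_ball q :: (real^'i) set)"
  unfolding compact_eq_bounded_closed
proof
  have "lq_ball q \<subseteq> cbox (- 1) (1 :: real^'i)"
    using lq_ball_component_le[OF q] by (force simp: mem_box_cart abs_le_iff)
  then show "bounded (lq_ball q :: (real^'i) set)"
    using bounded_cbox bounded_subset by blast
  have "continuous_on UNIV (\<lambda>c :: real^'i. \<Sum>i\<in>UNIV. \<bar>c $ i\<bar> powr q)"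
    using q by (intro continuous_intros continuous_on_powr') auto
  then show "closed (lq_ball q :: (real^'i) set)"
    unfolding lq_ball_def by (intro closed_Collect_le) auto
qed

lemma convex_lq_ball:
  assumes q: "q \<ge> 1"
  shows "convex (lq_ball q)"
proof (rule convexI)
  fix x y :: "real^'i" and a b :: real
  assume xy: "x \<in> lq_ball q" "y \<in> lq_ball q" and ab: "0 \<le> a" "0 \<le> b" "a + b = 1"
  have "(\<Sum>i\<in>UNIV. \<bar>a * x $ i + b * y $ i\<bar> powr q)
      \<le> (\<Sum>i\<in>UNIV. a * \<bar>x $ i\<bar> powr q + b * \<bar>y $ i\<bar> powr q)"
    by (intro sum_mono convex_powr_abs q ab)
  also have "\<dots> = a * (\<Sum>i\<in>UNIV. \<bar>x $ i\<bar> powr q) + b * (\<Sum>i\<in>UNIV. \<bar>y $ i\<bar> powr q)"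
    by (simp add: sum.distrib sum_distrib_left)
  also have "\<dots> \<le> a * 1 + b * 1"
    using xy ab by (intro add_mono mult_left_mono) (auto simp: lq_ball_def)
  finally show "a *\<^sub>R x + b *\<^sub>R y \<in> lq_ball q"
    using ab by (simp add: lq_ball_def)
qed

lemma zero_in_lq_ball: "0 \<in> lq_ball q"
  by (simp add: lq_ball_def)

lemma linear_lq_zonotope_map: "linear (\<lambda>c. \<Sum>i\<in>UNIV. c $ i *\<^sub>R v i)"
  by (rule linearI) (simp_all add: scaleR_add_left sum.distrib scaleR_sum_right)

lemma compact_lq_zonotope: "q > 0 \<Longrightarrow> compact (lq_zonotope q v)"
  unfolding lq_zonotope_def
  by (intro compact_continuous_image compact_lq_ball linear_continuous_on)
    (simp add: linear_lq_zonotope_map flip: linear_conv_bounded_linear)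

lemma zero_in_lq_zonotope: "0 \<in> lq_zonotope q v"
  unfolding lq_zonotope_def by (rule image_eqI[OF _ zero_in_lq_ball]) simp

lemma convex_body_lq_zonotope: "q \<ge> 1 \<Longrightarrow> convex_body (lq_zonotope q v)"
  using compact_lq_zonotope[of q v] zero_in_lq_zonotope[of q v]
  unfolding convex_body_def lq_zonotope_def
  by (auto intro!: convex_linear_image linear_lq_zonotope_map convex_lq_ball)

locale conjugate_exponents =
  fixes p q :: real
  assumes p_gt_1: "p > 1" and q_gt_1: "q > 1" and conj: "1 / p + 1 / q = 1"
begin

lemma conj_identities: "(p - 1) * q = p" "q / p = q - 1"
  using conj p_gt_1 q_gt_1 by (auto simp: field_simps)

text \<open>Hoelder's inequality, in the form needed for support functions: the sum of Young's inequalities for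
  the normalised terms.\<close>

lemma Holder_lq_ball:
  fixes c :: "real^'i" and a :: "'i \<Rightarrow> real"
  assumes c: "c \<in> lq_ball q"
  shows "(\<Sum>i\<in>UNIV. c $ i * a i) \<le> (\<Sum>i\<in>UNIV. \<bar>a i\<bar> powr p) powr (1 / p)"
proof (cases "(\<Sum>i\<in>UNIV. \<bar>a i\<bar> powr p) = 0")
  case True
  then have "a i = 0" for i
    by (simp add: sum_nonneg_eq_0_iff)
  then show ?thesis by simp
next
  case False
  define S where "S = (\<Sum>i\<in>UNIV. \<bar>a i\<bar> powr p)"
  have S: "S > 0"
    using False sum_nonneg[of UNIV "\<lambda>i. \<bar>a i\<bar> powr p"] by (simp add: S_def less_le)
  define N where "N = S powr (1 / p)"
  have N: "N > 0" "N powr p = S"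
    using S p_gt_1 by (auto simp: N_def powr_powr)
  have "(\<Sum>i\<in>UNIV. c $ i * a i) / N = (\<Sum>i\<in>UNIV. c $ i * a i / N)"
    by (simp add: sum_divide_distrib)
  also have "\<dots> \<le> (\<Sum>i\<in>UNIV. \<bar>a i\<bar> powr p / S / p + \<bar>c $ i\<bar> powr q / q)"
  proof (rule sum_mono)
    fix i
    have "c $ i * a i / N \<le> \<bar>c $ i * a i / N\<bar>"
      by (rule abs_ge_self)
    also have "\<dots> = (\<bar>a i\<bar> / N) * \<bar>c $ i\<bar>"
      using N by (simp add: abs_mult)
    also have "\<dots> \<le> (\<bar>a i\<bar> / N) powr p / p + \<bar>c $ i\<bar> powr q / q"
      using N by (intro Youngs_inequality p_gt_1 q_gt_1 conj) auto
    finally show "c $ i * a i / N \<le> \<bar>a i\<bar> powr p / S / p + \<bar>c $ i\<bar> powr q / q"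
      using N by (simp add: powr_divide)
  qed
  also have "\<dots> = S / S / p + (\<Sum>i\<in>UNIV. \<bar>c $ i\<bar> powr q) / q"
    by (simp add: sum.distrib S_def flip: sum_divide_distrib)
  also have "\<dots> \<le> 1 / p + 1 / q"
    using c S p_gt_1 q_gt_1 by (intro add_mono divide_right_mono) (auto simp: lq_ball_def)
  finally show ?thesis
    using N conj by (simp add: N_def[symmetric] S_def[symmetric] divide_simps)
qed

lemma Holder_lq_ball_attained:
  fixes a :: "'i::finite \<Rightarrow> real"
  shows "\<exists>c\<in>lq_ball q. (\<Sum>i\<in>UNIV. c $ i * a i) = (\<Sum>i\<in>UNIV. \<bar>a i\<bar> powr p) powr (1 / p)"
proof (cases "(\<Sum>i\<in>UNIV. \<bar>a i\<bar> powr p) = 0")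
  case True
  then show ?thesis
    by (intro bexI[OF _ zero_in_lq_ball]) simp
next
  case False
  define S where "S = (\<Sum>i\<in>UNIV. \<bar>a i\<bar> powr p)"
  have S: "S > 0"
    using False sum_nonneg[of UNIV "\<lambda>i. \<bar>a i\<bar> powr p"] by (simp add: S_def less_le)
  define c where "c = (\<chi> i. sgn (a i) * \<bar>a i\<bar> powr (p - 1) / S powr (1 / q))"
  have "\<bar>c $ i\<bar> powr q = \<bar>a i\<bar> powr p / S" for i
    using S conj_identities(1) q_gt_1 p_gt_1
    by (cases "a i = 0") (auto simp: c_def abs_mult abs_sgn_eq powr_divide powr_powr)
  then have "c \<in> lq_ball q"
    using S by (simp add: lq_ball_def S_def flip: sum_divide_distrib)
  moreover have "c $ i * a i = \<bar>a i\<bar> powr p / S powr (1 / q)" for i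
  proof -
    have "c $ i * a i = \<bar>a i\<bar> * \<bar>a i\<bar> powr (p - 1) / S powr (1 / q)"
      by (simp add: c_def abs_sgn)
    then show ?thesis
      by (simp add: powr_mult_base)
  qed
  then have "(\<Sum>i\<in>UNIV. c $ i * a i) = S / S powr (1 / q)"
    by (simp add: S_def flip: sum_divide_distrib)
  moreover have "S / S powr (1 / q) = S powr (1 / p)"
  proof -
    have "1 / p = 1 - 1 / q"
      using conj by simp
    then show ?thesis
      using S powr_diff[of S 1 "1 / q"] by simp
  qed
  ultimately show ?thesis
    by (auto simp: S_def)
qed

lemma support_fun_lq_zonotope:
  fixes v :: "'i::finite \<Rightarrow> 'a::euclidean_space"
  shows "support_fun (lq_zonotope q v) x = (\<Sum>i\<in>UNIV. \<bar>x \<bullet> v i\<bar> powr p) powr (1 / p)"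
proof -
  have eq: "x \<bullet> (\<Sum>i\<in>UNIV. c $ i *\<^sub>R v i) = (\<Sum>i\<in>UNIV. c $ i * (x \<bullet> v i))" for c :: "real^'i"
    by (simp add: inner_sum_right)
  from Holder_lq_ball_attained[of "\<lambda>i. x \<bullet> v i"] obtain c :: "real^'i" where c: "c \<in> lq_ball q"
    "(\<Sum>i\<in>UNIV. c $ i * (x \<bullet> v i)) = (\<Sum>i\<in>UNIV. \<bar>x \<bullet> v i\<bar> powr p) powr (1 / p)"
    by blast
  show ?thesis
    unfolding support_fun_def lq_zonotope_def image_image eq
  proof (rule cSup_eq_maximum)
    show "(\<Sum>i\<in>UNIV. \<bar>x \<bullet> v i\<bar> powr p) powr (1 / p)
        \<in> (\<lambda>c :: real^'i. \<Sum>i\<in>UNIV. c $ i * (x \<bullet> v i)) ` lq_ball q"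
      using c by (intro image_eqI[of _ _ c]) simp_all
  qed (auto intro: Holder_lq_ball)
qed

lemma support_fun_powr_lq_zonotope:
  fixes v :: "'i::finite \<Rightarrow> 'a::euclidean_space"
  shows "support_fun (lq_zonotope q v) x powr p = (\<Sum>i\<in>UNIV. \<bar>x \<bullet> v i\<bar> powr p)"
  using p_gt_1 by (simp add: support_fun_lq_zonotope powr_powr sum_nonneg)

text \<open>In particular, a family of parallel generators may be replaced by a single one.\<close>

lemma lq_zonotope_eqI:
  fixes v :: "'i::finite \<Rightarrow> 'a::euclidean_space" and w :: "'j::finite \<Rightarrow> 'a"
  assumes "\<And>x. (\<Sum>i\<in>UNIV. \<bar>x \<bullet> v i\<bar> powr p) = (\<Sum>i\<in>UNIV. \<bar>x \<bullet> w i\<bar> powr p)"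
  shows "lq_zonotope q v = lq_zonotope q w"
  using assms q_gt_1 by (intro convex_body_eqI) (auto simp: support_fun_lq_zonotope convex_body_lq_zonotope)

lemma Lp_sum_lq_zonotope:
  fixes u :: "'i::finite \<Rightarrow> 'a::euclidean_space" and v :: "'j::finite \<Rightarrow> 'a" and w :: "'k::finite \<Rightarrow> 'a"
  assumes "\<And>x. (\<Sum>i\<in>UNIV. \<bar>x \<bullet> w i\<bar> powr p)
    = (\<Sum>i\<in>UNIV. \<bar>x \<bullet> u i\<bar> powr p) + (\<Sum>i\<in>UNIV. \<bar>x \<bullet> v i\<bar> powr p)"
  shows "Lp_sum p (lq_zonotope q u) (lq_zonotope q v) = lq_zonotope q w"
  using assms p_gt_1 q_gt_1
  by (intro Lp_sum_eqI) (auto simp: support_fun_powr_lq_zonotope convex_body_lq_zonotope zero_in_lq_zonotope)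

lemma lq_zonotope_segment:
  fixes v :: "'a::euclidean_space"
  shows "lq_zonotope q (\<lambda>_ :: unit. v) = closed_segment (- v) v"
proof -
  have "closed_segment (- v) v = (\<lambda>t. t *\<^sub>R v) ` closed_segment (- 1) 1"
    using closed_segment_linear_image[of "\<lambda>t. t *\<^sub>R v" "-1" 1]
    by (simp add: linear_iff scaleR_add_left)
  also have "\<dots> = (\<lambda>c :: real^unit. c $ () *\<^sub>R v) ` lq_ball q"
  proof -
    have "(\<lambda>c :: real^unit. c $ ()) ` lq_ball q = closed_segment (- 1) 1"
    proof (intro equalityI subsetI)
      fix t :: real
      assume "t \<in> closed_segment (- 1) 1"
      then have "\<bar>t\<bar> powr q \<le> 1"
        using q_gt_1 by (simp add: closed_segment_eq_real_ivl abs_le_iff powr_le1)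
      then show "t \<in> (\<lambda>c :: real^unit. c $ ()) ` lq_ball q"
        by (intro image_eqI[of _ _ "\<chi> i. t"]) (auto simp: lq_ball_def UNIV_unit)
    next
      fix t :: real
      assume "t \<in> (\<lambda>c :: real^unit. c $ ()) ` lq_ball q"
      then show "t \<in> closed_segment (- 1) 1"
        using lq_ball_component_le[of q] q_gt_1 by (force simp: closed_segment_eq_real_ivl abs_le_iff)
    qed
    then show ?thesis
      using image_image[of "\<lambda>t. t *\<^sub>R v" "\<lambda>c :: real^unit. c $ ()" "lq_ball q"] by simp
  qed
  finally show ?thesis
    by (simp add: lq_zonotope_def UNIV_unit)
qed

text \<open>The generators are added one at a time. Those that are not yet present are replaced by \<open>0\<close>, which
  keeps the index type fixed during the induction.\<close>

lemma Lp_zonotope_lq_zonotope: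
  fixes v :: "'i::finite \<Rightarrow> 'a::euclidean_space"
  shows "Lp_zonotope p (lq_zonotope q v)"
proof -
  have "Lp_zonotope p (lq_zonotope q (\<lambda>i. if i \<in> I then v i else 0))" if "finite I" for I :: "'i set"
    using that
  proof induction
    case empty
    have "lq_zonotope q (\<lambda>i. if i \<in> {} then v i else 0) = lq_zonotope q (\<lambda>_ :: unit. 0 :: 'a)"
      by (rule lq_zonotope_eqI) simp
    then show ?case
      using Lp_zonotope.segment[of p "0 :: 'a"] by (simp only: lq_zonotope_segment)
  next
    case (insert j I)
    have "Lp_sum p (lq_zonotope q (\<lambda>i. if i \<in> I then v i else 0)) (lq_zonotope q (\<lambda>_ :: unit. v j))
      = lq_zonotope q (\<lambda>i. if i \<in> insert j I then v i else 0)"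
    proof (rule Lp_sum_lq_zonotope)
      fix x
      have "(\<Sum>i\<in>UNIV. \<bar>x \<bullet> (if i \<in> insert j I then v i else 0)\<bar> powr p)
          = (\<Sum>i\<in>UNIV. \<bar>x \<bullet> (if i \<in> I then v i else 0)\<bar> powr p + (if i = j then \<bar>x \<bullet> v j\<bar> powr p else 0))"
        using insert.hyps by (intro sum.cong) auto
      then show "(\<Sum>i\<in>UNIV. \<bar>x \<bullet> (if i \<in> insert j I then v i else 0)\<bar> powr p)
          = (\<Sum>i\<in>UNIV. \<bar>x \<bullet> (if i \<in> I then v i else 0)\<bar> powr p) + (\<Sum>i\<in>(UNIV :: unit set). \<bar>x \<bullet> v j\<bar> powr p)"
        by (simp add: sum.distrib)
    qed
    then show ?case
      using Lp_zonotope.sum[OF insert.IH, of "v j"] by (simp add: lq_zonotope_segment)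
  qed
  from this[of UNIV] show ?thesis by simp
qed

end

section \<open>Splitting a generator symmetrically: inclusions\<close>

text \<open>A quantitative form of uniform convexity. Convexity of \<open>x\<^sup>q\<^sup>/\<^sup>2\<close> bounds the mean of \<open>\<bar>m + d\<bar>\<^sup>q\<close> and
  \<open>\<bar>m - d\<bar>\<^sup>q\<close> from below by \<open>(m\<^sup>2 + d\<^sup>2)\<^sup>q\<^sup>/\<^sup>2 = (m\<^sup>2 + d\<^sup>2) (m\<^sup>2 + d\<^sup>2)\<^sup>q\<^sup>/\<^sup>2\<^sup>-\<^sup>1\<close>, and in the second factor
  \<open>m\<^sup>2 + d\<^sup>2\<close> may be replaced by \<open>m\<^sup>2\<close> or by \<open>d\<^sup>2\<close>.\<close>

lemma two_point_inequality:
  fixes m d :: real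
  assumes q: "q \<ge> 2"
  shows "2 * \<bar>m\<bar> powr q + 2 * (\<bar>m\<bar> powr (q - 2) * d\<^sup>2) \<le> \<bar>m + d\<bar> powr q + \<bar>m - d\<bar> powr q"
    and "2 * \<bar>m\<bar> powr q + 2 * \<bar>d\<bar> powr q \<le> \<bar>m + d\<bar> powr q + \<bar>m - d\<bar> powr q"
proof -
  have sq: "(z\<^sup>2) powr r = \<bar>z\<bar> powr (2 * r)" for z r :: real
    using powr_powr[of "\<bar>z\<bar>" 2 r] by simp
  have low: "x * \<bar>z\<bar> powr (q - 2) \<le> x * (m\<^sup>2 + d\<^sup>2) powr (q / 2 - 1)"
    if "z\<^sup>2 \<le> m\<^sup>2 + d\<^sup>2" "x \<ge> 0" for x z
  proof -
    have "(z\<^sup>2) powr (q / 2 - 1) \<le> (m\<^sup>2 + d\<^sup>2) powr (q / 2 - 1)"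
      using q that by (intro powr_mono2) auto
    moreover have "(z\<^sup>2) powr (q / 2 - 1) = \<bar>z\<bar> powr (q - 2)"
      by (simp add: sq algebra_simps)
    ultimately show ?thesis
      using that by (intro mult_left_mono) auto
  qed
  have top: "z\<^sup>2 * \<bar>z\<bar> powr (q - 2) = \<bar>z\<bar> powr q" for z :: real
  proof (cases "z = 0")
    case False
    then show ?thesis
      using powr_add[of "\<bar>z\<bar>" 2 "q - 2"] by simp
  qed simp
  have "(m\<^sup>2 + d\<^sup>2) * (m\<^sup>2 + d\<^sup>2) powr (q / 2 - 1) = (m\<^sup>2 + d\<^sup>2) powr (q / 2)"
    by (subst powr_mult_base) auto
  also have "\<dots> = \<bar>(1 / 2) * (m + d)\<^sup>2 + (1 / 2) * (m - d)\<^sup>2\<bar> powr (q / 2)"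
    by (simp add: power2_eq_square algebra_simps)
  also have "\<dots> \<le> (1 / 2) * \<bar>(m + d)\<^sup>2\<bar> powr (q / 2) + (1 / 2) * \<bar>(m - d)\<^sup>2\<bar> powr (q / 2)"
    using q by (intro convex_powr_abs) auto
  also have "\<dots> = (1 / 2) * (\<bar>m + d\<bar> powr q + \<bar>m - d\<bar> powr q)"
    by (simp add: sq)
  finally have mean: "2 * (m\<^sup>2 * (m\<^sup>2 + d\<^sup>2) powr (q / 2 - 1)) + 2 * (d\<^sup>2 * (m\<^sup>2 + d\<^sup>2) powr (q / 2 - 1))
      \<le> \<bar>m + d\<bar> powr q + \<bar>m - d\<bar> powr q"
    by (simp add: algebra_simps)
  show "2 * \<bar>m\<bar> powr q + 2 * (\<bar>m\<bar> powr (q - 2) * d\<^sup>2) \<le> \<bar>m + d\<bar> powr q + \<bar>m - d\<bar> powr q"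
    using mean low[of m "m\<^sup>2"] low[of m "d\<^sup>2"] top[of m] by (simp add: mult.commute)
  show "2 * \<bar>m\<bar> powr q + 2 * \<bar>d\<bar> powr q \<le> \<bar>m + d\<bar> powr q + \<bar>m - d\<bar> powr q"
    using mean low[of m "m\<^sup>2"] low[of d "d\<^sup>2"] top[of m] top[of d] by simp
qed

lemma scaled_lq_ball_iff:
  assumes "r > 0"
  shows "x \<in> (*\<^sub>R) r ` lq_ball q \<longleftrightarrow> (\<Sum>i\<in>UNIV. \<bar>x $ i\<bar> powr q) \<le> r powr q"
proof -
  have "x \<in> (*\<^sub>R) r ` lq_ball q \<longleftrightarrow> (1 / r) *\<^sub>R x \<in> lq_ball q"
    using assms by (auto simp: image_iff intro!: bexI[of _ "(1 / r) *\<^sub>R x"])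
  also have "\<dots> \<longleftrightarrow> (\<Sum>i\<in>UNIV. \<bar>x $ i\<bar> powr q / r powr q) \<le> 1"
    using assms by (simp add: lq_ball_def abs_mult powr_divide)
  also have "\<dots> \<longleftrightarrow> (\<Sum>i\<in>UNIV. \<bar>x $ i\<bar> powr q) \<le> r powr q"
    using assms by (simp add: divide_le_eq flip: sum_divide_distrib)
  finally show ?thesis .
qed

lemma scaled_convex_add:
  fixes S :: "'a::real_vector set"
  assumes S: "convex S" and r: "r > 0" "t > 0"
    and x: "x \<in> (*\<^sub>R) r ` S" and y: "y \<in> (*\<^sub>R) t ` S"
  shows "x + y \<in> (*\<^sub>R) (r + t) ` S"
proof -
  obtain a b where ab: "a \<in> S" "b \<in> S" "x = r *\<^sub>R a" "y = t *\<^sub>R b"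
    using x y by auto
  have "(r / (r + t)) *\<^sub>R a + (t / (r + t)) *\<^sub>R b \<in> S"
    using S ab r by (intro convexD) (auto simp: add_divide_distrib[symmetric])
  moreover have "x + y = (r + t) *\<^sub>R ((r / (r + t)) *\<^sub>R a + (t / (r + t)) *\<^sub>R b)"
    using ab r by (simp add: scaleR_add_right)
  ultimately show ?thesis by blast
qed

lemma sum_UNIV_option:
  fixes f :: "'i::finite option \<Rightarrow> 'a::comm_monoid_add"
  shows "(\<Sum>i\<in>UNIV. f i) = f None + (\<Sum>i\<in>UNIV. f (Some i))"
  by (simp add: UNIV_option_conv sum.reindex)

lemma sum_UNIV_split_two:
  fixes f :: "'i::finite \<Rightarrow> real"
  assumes "j \<noteq> k"
  shows "(\<Sum>i\<in>UNIV. f i) = f j + f k + (\<Sum>i\<in>UNIV - {j, k}. f i)"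
proof -
  have "(\<Sum>i\<in>UNIV - {j}. f i) = f k + (\<Sum>i\<in>UNIV - {j} - {k}. f i)"
    using assms by (intro sum.remove) auto
  then show ?thesis
    using sum.remove[of UNIV j f] by (simp add: Diff_insert2[symmetric] insert_commute)
qed

text \<open>The image of the \<open>l\<^sub>q\<close> ball under this map is the zonotope with the generators \<open>e\<^sub>k + \<sigma> e\<^sub>j\<close> (index
  \<open>Some k\<close>), \<open>e\<^sub>k - \<sigma> e\<^sub>j\<close> (index \<open>None\<close>) and \<open>e\<^sub>i\<close> for \<open>i \<noteq> k\<close>, with the coordinate \<open>k\<close> divided by
  \<open>2\<^sup>1\<^sup>/\<^sup>p\<close>. With this normalisation the image for \<open>\<sigma> = 0\<close> is the \<open>l\<^sub>q\<close> ball itself.\<close>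

definition balanced_map :: "real \<Rightarrow> 'n \<Rightarrow> 'n \<Rightarrow> real \<Rightarrow> real^('n option) \<Rightarrow> real^'n" where
  "balanced_map p j k \<sigma> c = (\<chi> i.
     if i = j then c $ Some j + \<sigma> * (c $ Some k - c $ None)
     else if i = k then (c $ Some k + c $ None) / 2 powr (1 / p)
     else c $ Some i)"

context conjugate_exponents
begin

context
  fixes j k :: "'n::finite" and \<sigma> :: real
  assumes jk: "j \<noteq> k" and \<sigma>: "\<sigma> > 0" and q2: "q \<ge> 2"
begin

lemma balanced_map_k:
  "\<bar>balanced_map p j k s c $ k\<bar> powr q = 2 * \<bar>(c $ Some k + c $ None) / 2\<bar> powr q"
proof -
  have "2 powr q = 2 * (2 powr (1 / p)) powr q"
    using conj_identities(2) by (simp add: powr_powr powr_diff)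
  then show ?thesis
    using jk by (simp add: balanced_map_def powr_divide)
qed

lemma lq_ball_option_split:
  fixes c :: "real^('n option)"
  assumes "c \<in> lq_ball q"
  shows "(\<Sum>i\<in>UNIV - {j, k}. \<bar>c $ Some i\<bar> powr q) + \<bar>c $ Some j\<bar> powr q
    + (\<bar>c $ Some k\<bar> powr q + \<bar>c $ None\<bar> powr q) \<le> 1"
  using assms sum_UNIV_split_two[OF jk, of "\<lambda>i. \<bar>c $ Some i\<bar> powr q"]
  by (simp add: lq_ball_def sum_UNIV_option)

text \<open>Put \<open>c $ Some k = m + d\<close> and \<open>c $ None = m - d\<close>, with \<open>\<delta> \<le> \<bar>m\<bar>\<close>. The point \<open>y\<close> for \<open>\<sigma> = 0\<close> lies in the ball of
  radius \<open>1 - \<kappa> d\<^sup>2 / q\<close>, where \<open>\<kappa> = 2 \<delta>\<^sup>q\<^sup>-\<^sup>2\<close>, by the first two-point inequality. The tilt moves it by \<open>2 \<sigma> \<bar>d\<bar>\<close>, which is at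
  most \<open>\<kappa> d\<^sup>2 / q + q \<sigma>\<^sup>2 / \<kappa>\<close>. The terms in \<open>d\<^sup>2\<close> cancel.\<close>

lemma balanced_map_outer:
  fixes c :: "real^('n option)"
  assumes c: "c \<in> lq_ball q" and \<delta>: "\<delta> > 0" "\<delta> \<le> \<bar>(c $ Some k + c $ None) / 2\<bar>"
  shows "balanced_map p j k \<sigma> c \<in> (*\<^sub>R) (1 + q / (2 * \<delta> powr (q - 2)) * \<sigma>\<^sup>2) ` lq_ball q"
proof -
  define m d where "m = (c $ Some k + c $ None) / 2" and "d = (c $ Some k - c $ None) / 2"
  have md: "c $ Some k = m + d" "c $ None = m - d"
    by (simp_all add: m_def d_def field_simps)
  define \<kappa> where "\<kappa> = 2 * \<delta> powr (q - 2)"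
  have \<kappa>: "\<kappa> > 0"
    using \<delta> by (simp add: \<kappa>_def)
  define y where "y = balanced_map p j k 0 c"
  have "\<kappa> * d\<^sup>2 \<le> 2 * (\<bar>m\<bar> powr (q - 2) * d\<^sup>2)"
    using \<delta> q2 by (auto simp: \<kappa>_def m_def intro!: mult_right_mono powr_mono2)
  then have "2 * \<bar>m\<bar> powr q + \<kappa> * d\<^sup>2 \<le> \<bar>m + d\<bar> powr q + \<bar>m - d\<bar> powr q"
    using two_point_inequality(1)[OF q2, of m d] by simp
  then have "(\<Sum>i\<in>UNIV - {j, k}. \<bar>c $ Some i\<bar> powr q) + \<bar>c $ Some j\<bar> powr q
      + 2 * \<bar>m\<bar> powr q \<le> 1 - \<kappa> * d\<^sup>2"
    using lq_ball_option_split[OF c] unfolding md by linarith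
  moreover have "(\<Sum>i\<in>UNIV. \<bar>y $ i\<bar> powr q)
      = (\<Sum>i\<in>UNIV - {j, k}. \<bar>c $ Some i\<bar> powr q) + \<bar>c $ Some j\<bar> powr q + 2 * \<bar>m\<bar> powr q"
  proof -
    have "(\<Sum>i\<in>UNIV - {j, k}. \<bar>y $ i\<bar> powr q) = (\<Sum>i\<in>UNIV - {j, k}. \<bar>c $ Some i\<bar> powr q)"
      by (intro sum.cong) (auto simp: y_def balanced_map_def)
    moreover have "y $ j = c $ Some j"
      by (simp add: y_def balanced_map_def)
    moreover have "\<bar>y $ k\<bar> powr q = 2 * \<bar>m\<bar> powr q"
      unfolding y_def m_def by (rule balanced_map_k)
    ultimately show ?thesis
      using sum_UNIV_split_two[OF jk, of "\<lambda>i. \<bar>y $ i\<bar> powr q"] by simp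
  qed
  ultimately have sum_y: "(\<Sum>i\<in>UNIV. \<bar>y $ i\<bar> powr q) \<le> 1 - \<kappa> * d\<^sup>2"
    by simp
  define r where "r = 1 - \<kappa> * d\<^sup>2 / q"
  have "0 \<le> (\<Sum>i\<in>UNIV. \<bar>y $ i\<bar> powr q)"
    by (intro sum_nonneg) simp
  then have small: "0 \<le> 1 - \<kappa> * d\<^sup>2"
    using sum_y by linarith
  then have "\<kappa> * d\<^sup>2 / q < 1"
    using q_gt_1 by (simp add: divide_less_eq)
  then have r: "r > 0"
    by (simp add: r_def)
  \<comment> \<open>Concavity of the \<open>q\<close>-th root, as Young's inequality with second factor \<open>1\<close>.\<close>
  have "(1 - \<kappa> * d\<^sup>2) powr (1 / q) \<le> r"
  proof (cases "1 - \<kappa> * d\<^sup>2 = 0")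
    case False
    then have "1 - \<kappa> * d\<^sup>2 > 0"
      using small by simp
    then have "(1 - \<kappa> * d\<^sup>2) powr (1 / q) * 1 powr (1 / p) \<le> (1 / q) * (1 - \<kappa> * d\<^sup>2) + (1 / p) * 1"
      using conj p_gt_1 q_gt_1 by (intro Youngs_inequality_0) auto
    also have "\<dots> = r"
      using conj by (simp add: r_def diff_divide_distrib)
    finally show ?thesis
      by simp
  qed (use r in simp)
  then have "((1 - \<kappa> * d\<^sup>2) powr (1 / q)) powr q \<le> r powr q"
    using q_gt_1 by (intro powr_mono2) auto
  then have "1 - \<kappa> * d\<^sup>2 \<le> r powr q"
    using small q_gt_1 by (simp add: powr_powr)
  then have y: "y \<in> (*\<^sub>R) r ` lq_ball q"
    using sum_y r by (simp add: scaled_lq_ball_iff)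
  define t where "t = \<kappa> * d\<^sup>2 / q + q / \<kappa> * \<sigma>\<^sup>2"
  have t: "t > 0"
    using \<kappa> \<sigma> q_gt_1 by (auto simp: t_def intro!: add_nonneg_pos)
  have "\<bar>2 * \<sigma> * d\<bar> \<le> t"
  proof -
    \<comment> \<open>The arithmetic-geometric mean inequality for the two terms of \<open>t\<close>.\<close>
    have "0 \<le> (\<kappa> / q * \<bar>d\<bar> - \<sigma>)\<^sup>2 / (\<kappa> / q)"
      using \<kappa> q_gt_1 by simp
    also have "\<dots> = t - 2 * \<sigma> * \<bar>d\<bar>"
      using \<kappa> q_gt_1 by (simp add: t_def power2_eq_square field_simps)
    finally show ?thesis
      using \<sigma> by (simp add: abs_mult)
  qed
  then have "\<bar>2 * \<sigma> * d\<bar> powr q \<le> t powr q"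
    using q_gt_1 by (intro powr_mono2) auto
  moreover have "(\<Sum>i\<in>UNIV. \<bar>(axis j (2 * \<sigma> * d) :: real^'n) $ i\<bar> powr q) = \<bar>2 * \<sigma> * d\<bar> powr q"
    using jk by (subst sum_UNIV_split_two[OF jk]) (simp add: axis_def)
  ultimately have "axis j (2 * \<sigma> * d) \<in> (*\<^sub>R) t ` (lq_ball q :: (real^'n) set)"
    using t by (simp add: scaled_lq_ball_iff)
  then have "y + axis j (2 * \<sigma> * d) \<in> (*\<^sub>R) (r + t) ` lq_ball q"
    using scaled_convex_add[OF convex_lq_ball r t y] q_gt_1 by simp
  moreover have "y + axis j (2 * \<sigma> * d) = balanced_map p j k \<sigma> c"
    by (auto simp: y_def d_def balanced_map_def vec_eq_iff axis_def)
  ultimately show ?thesis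
    by (simp add: r_def t_def \<kappa>_def)
qed

text \<open>Put \<open>c $ Some k = m + d\<close> and \<open>c $ None = m - d\<close>. The coordinate \<open>j\<close> of the image is \<open>c $ Some j + 2 \<sigma> d\<close>. Divided by \<open>E = 1 + 2 \<sigma>\<^sup>p\<close>, it is the convex
  combination of \<open>c $ Some j\<close> and \<open>\<sigma>\<^sup>1\<^sup>-\<^sup>p d\<close> with weights \<open>1 / E\<close> and \<open>2 \<sigma>\<^sup>p / E\<close>, so its \<open>q\<close>-th power is at most
  \<open>\<bar>c $ Some j\<bar>\<^sup>q + 2 \<bar>d\<bar>\<^sup>q\<close>, which the second two-point inequality pays for.\<close>

lemma balanced_map_inner:
  fixes c :: "real^('n option)"
  assumes c: "c \<in> lq_ball q"
  shows "balanced_map p j k \<sigma> c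
    \<in> stretch (\<lambda>i. if i = j then 1 + 2 * \<sigma> powr p else 1) ` lq_ball q"
proof -
  define m d where "m = (c $ Some k + c $ None) / 2" and "d = (c $ Some k - c $ None) / 2"
  have md: "c $ Some k = m + d" "c $ None = m - d"
    by (simp_all add: m_def d_def field_simps)
  define E where "E = 1 + 2 * \<sigma> powr p"
  have E: "E \<ge> 1"
    by (simp add: E_def)
  let ?z = "balanced_map p j k \<sigma> c"
  define x where "x = (\<chi> i. if i = j then ?z $ j / E else ?z $ i)"
  have "\<sigma> powr p * \<sigma> powr (1 - p) = \<sigma>"
    using \<sigma> by (simp flip: powr_add)
  then have z_j: "?z $ j / E = 1 / E * c $ Some j + (2 * \<sigma> powr p / E) * (d * \<sigma> powr (1 - p))"
    using E by (simp add: balanced_map_def d_def field_simps)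
  have "1 / E + 2 * \<sigma> powr p / E = 1"
    using E by (simp add: E_def[symmetric] flip: add_divide_distrib)
  then have "\<bar>1 / E * c $ Some j + (2 * \<sigma> powr p / E) * (d * \<sigma> powr (1 - p))\<bar> powr q
      \<le> 1 / E * \<bar>c $ Some j\<bar> powr q + (2 * \<sigma> powr p / E) * \<bar>d * \<sigma> powr (1 - p)\<bar> powr q"
    using E q_gt_1 by (intro convex_powr_abs) auto
  also have "\<bar>d * \<sigma> powr (1 - p)\<bar> powr q = \<bar>d\<bar> powr q / \<sigma> powr p"
  proof -
    have "(1 - p) * q = - p"
      using conj_identities(1) by (simp add: algebra_simps)
    then show ?thesis
      by (simp add: abs_mult powr_mult powr_powr powr_minus_divide)
  qed
  also have "1 / E * \<bar>c $ Some j\<bar> powr q + (2 * \<sigma> powr p / E) * (\<bar>d\<bar> powr q / \<sigma> powr p)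
      = (\<bar>c $ Some j\<bar> powr q + 2 * \<bar>d\<bar> powr q) / E"
    using E \<sigma> by (simp add: field_simps)
  also have "\<dots> \<le> (\<bar>c $ Some j\<bar> powr q + 2 * \<bar>d\<bar> powr q) / 1"
    using E by (intro divide_left_mono) auto
  finally have "\<bar>x $ j\<bar> powr q \<le> \<bar>c $ Some j\<bar> powr q + 2 * \<bar>d\<bar> powr q"
    by (simp add: x_def z_j)
  moreover have "(\<Sum>i\<in>UNIV. \<bar>x $ i\<bar> powr q)
      = \<bar>x $ j\<bar> powr q + 2 * \<bar>m\<bar> powr q + (\<Sum>i\<in>UNIV - {j, k}. \<bar>c $ Some i\<bar> powr q)"
  proof -
    have "\<bar>x $ k\<bar> powr q = 2 * \<bar>m\<bar> powr q"
      using jk balanced_map_k[of _ c] by (simp add: x_def m_def)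
    moreover have "(\<Sum>i\<in>UNIV - {j, k}. \<bar>x $ i\<bar> powr q) = (\<Sum>i\<in>UNIV - {j, k}. \<bar>c $ Some i\<bar> powr q)"
      by (intro sum.cong) (auto simp: x_def balanced_map_def)
    ultimately show ?thesis
      using sum_UNIV_split_two[OF jk, of "\<lambda>i. \<bar>x $ i\<bar> powr q"] by simp
  qed
  ultimately have "x \<in> lq_ball q"
    using two_point_inequality(2)[OF q2, of m d] lq_ball_option_split[OF c] unfolding md lq_ball_def
    by simp
  moreover have "?z = stretch (\<lambda>i. if i = j then E else 1) x"
    using E by (simp add: x_def stretch_def vec_eq_iff)
  ultimately show ?thesis
    unfolding E_def by (intro image_eqI[of _ _ x])
qed

end

end

section \<open>Splitting a generator symmetrically: volume\<close>

lemma one_plus_power_le: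
  fixes y :: real
  assumes "0 \<le> y" "y \<le> 1"
  shows "(1 + y) ^ n \<le> 1 + 3 ^ n * y"
proof (induction n)
  case (Suc n)
  have "(1 + y) ^ Suc n \<le> (1 + y) * (1 + 3 ^ n * y)"
    using Suc assms by (simp add: mult_left_mono)
  also have "\<dots> = 1 + y * (1 + 3 ^ n + 3 ^ n * y)"
    by (simp add: algebra_simps)
  also have "\<dots> \<le> 1 + y * (3 ^ n + 3 ^ n + 3 ^ n * 1)"
    using assms by (intro add_left_mono mult_left_mono add_mono) auto
  finally show ?case
    by (simp add: mult_ac)
qed (use assms in simp)

lemma cube_subset_lq_ball:
  assumes "q > 0"
  defines "r \<equiv> (1 / real CARD('i)) powr (1 / q)"
  shows "cbox (\<chi> i. - r) (\<chi> i. r) \<subseteq> (lq_ball q :: (real^'i) set)"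
proof
  fix x :: "real^'i"
  assume x: "x \<in> cbox (\<chi> i. - r) (\<chi> i. r)"
  have "(\<Sum>i\<in>UNIV. \<bar>x $ i\<bar> powr q) \<le> (\<Sum>i\<in>(UNIV :: 'i set). 1 / real CARD('i))"
  proof (rule sum_mono)
    fix i
    have "\<bar>x $ i\<bar> \<le> r"
      using x by (simp add: mem_box_cart abs_le_iff) (metis minus_le_iff)
    then have "\<bar>x $ i\<bar> powr q \<le> r powr q"
      using assms by (intro powr_mono2) auto
    also have "\<dots> = 1 / real CARD('i)"
      using assms by (simp add: r_def powr_powr)
    finally show "\<bar>x $ i\<bar> powr q \<le> 1 / real CARD('i)" .
  qed
  then show "x \<in> lq_ball q"
    by (simp add: lq_ball_def)
qed

lemma measure_lq_ball_pos:
  assumes q: "q > 0"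
  shows "measure lebesgue (lq_ball q :: (real^'i) set) > 0"
proof -
  define r where "r = (1 / real CARD('i)) powr (1 / q)"
  have r: "r > 0"
    by (simp add: r_def)
  let ?C = "cbox (\<chi> i. - r) (\<chi> i. r) :: (real^'i) set"
  have ne: "?C \<noteq> {}"
    using r by (simp add: interval_ne_empty_cart)
  have "0 < measure lebesgue ?C"
    using r by (simp add: content_cbox_cart[OF ne] prod_pos)
  also have "\<dots> \<le> measure lebesgue (lq_ball q :: (real^'i) set)"
    using cube_subset_lq_ball[OF q, where 'i = 'i]
    by (intro measure_mono_fmeasurable) (auto simp: r_def q compact_lq_ball lmeasurable_compact)
  finally show ?thesis .
qed

lemma linear_balanced_map: "linear (balanced_map p j k \<sigma>)"
  by (rule linearI) (auto simp: balanced_map_def vec_eq_iff algebra_simps add_divide_distrib)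

lemma compact_slab:
  assumes "q > 0"
  shows "compact (lq_ball q \<inter> {x :: real^'n. \<bar>x $ k\<bar> \<le> h})"
  by (intro compact_Int_closed compact_lq_ball assms closed_Collect_le continuous_intros)

lemma measure_slab_le:
  fixes k :: "'n::finite"
  assumes q: "q > 0" and h: "h > 0"
  shows "measure lebesgue (lq_ball q \<inter> {x :: real^'n. \<bar>x $ k\<bar> \<le> h}) \<le> 2 ^ CARD('n) * h"
proof -
  define v :: "real^'n" where "v = (\<chi> i. if i = k then h else 1)"
  have ne: "cbox (- v) v \<noteq> {}"
    using h by (simp add: interval_ne_empty_cart v_def)
  have "lq_ball q \<inter> {x. \<bar>x $ k\<bar> \<le> h} \<subseteq> cbox (- v) v"
    using lq_ball_component_le[OF q] by (force simp: mem_box_cart v_def abs_le_iff)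
  then have "measure lebesgue (lq_ball q \<inter> {x. \<bar>x $ k\<bar> \<le> h}) \<le> measure lebesgue (cbox (- v) v)"
    by (intro measure_mono_fmeasurable lmeasurable_cbox fmeasurableD lmeasurable_compact compact_slab q)
  also have "\<dots> = (\<Prod>i\<in>UNIV. v $ i - (- v) $ i)"
    by (simp add: content_cbox_cart[OF ne])
  also have "\<dots> = (\<Prod>i\<in>UNIV. 2 * (if i = k then h else 1))"
    by (intro prod.cong) (simp_all add: v_def)
  also have "\<dots> = 2 ^ CARD('n) * h"
    by (simp add: prod.distrib)
  finally show ?thesis .
qed

text \<open>The image is covered by the part of a ball of radius \<open>l = 1 + C \<sigma>\<^sup>2\<close> outside the slab \<open>W\<close> of the unit
  ball and by a stretched copy of \<open>W\<close>. Hence its measure exceeds that of the unit ball by at most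
  \<open>l\<^sup>n - 1\<close> times that measure, of order \<open>\<sigma>\<^sup>2\<close>, plus \<open>2 \<sigma>\<^sup>p\<close> times the measure of \<open>W\<close>. The width \<open>h\<close>
  of the slab is chosen for the second contribution, then the bound on \<open>\<sigma>\<close> for the first.\<close>

lemma (in conjugate_exponents) measure_balanced_image_le:
  fixes j k :: "'n::finite"
  assumes jk: "j \<noteq> k" and p2: "p < 2" and \<eta>: "\<eta> > 0"
  shows "\<exists>\<sigma>0>0. \<forall>\<sigma>. 0 < \<sigma> \<and> \<sigma> < \<sigma>0 \<longrightarrow>
    measure lebesgue (balanced_map p j k \<sigma> ` lq_ball q)
      \<le> (1 + \<eta> * \<sigma> powr p) * measure lebesgue (lq_ball q :: (real^'n) set)"
proof -
  have q2: "q \<ge> 2"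
  proof -
    have "1 / 2 < 1 / p"
      using p2 p_gt_1 by (simp add: field_simps)
    then have "1 / q \<le> 1 / 2"
      using conj by linarith
    then show ?thesis
      using q_gt_1 by (simp add: field_simps)
  qed
  let ?B = "lq_ball q :: (real^'n) set" and ?n = "CARD('n)"
  define \<beta> where "\<beta> = measure lebesgue ?B"
  have \<beta>: "\<beta> > 0"
    unfolding \<beta>_def using q_gt_1 by (intro measure_lq_ball_pos) auto
  define h where "h = \<eta> * \<beta> / (4 * 2 ^ ?n)"
  have h: "h > 0"
    using \<eta> \<beta> by (simp add: h_def)
  \<comment> \<open>The absolute value of the coordinate \<open>k\<close> of the image of a point \<open>c\<close> exceeds \<open>h\<close> iff \<open>\<delta> < \<bar>c $ Some k + c $ None\<bar> / 2\<close>.\<close>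
  define \<delta> where "\<delta> = h * 2 powr (1 / p) / 2"
  have \<delta>: "\<delta> > 0"
    using h by (simp add: \<delta>_def)
  define C where "C = q / (2 * \<delta> powr (q - 2))"
  have C: "C > 0"
    using \<delta> q_gt_1 by (simp add: C_def)
  \<comment> \<open>For \<open>\<sigma>\<^sup>2\<^sup>-\<^sup>p \<le> A\<close> and \<open>C \<sigma>\<^sup>2 \<le> 1\<close>, the bound \<open>(1 + y)\<^sup>n \<le> 1 + 3\<^sup>n y\<close> applies with \<open>3\<^sup>n C \<sigma>\<^sup>2 \<le> \<eta> \<sigma>\<^sup>p / 2\<close>.\<close>
  define A where "A = \<eta> / (2 * 3 ^ ?n * C)"
  have A: "A > 0"
    using \<eta> C by (simp add: A_def)
  define \<sigma>0 where "\<sigma>0 = min (A powr (1 / (2 - p))) (sqrt (1 / C))"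
  have "\<sigma>0 > 0"
    using A C by (simp add: \<sigma>0_def)
  moreover have "measure lebesgue (balanced_map p j k \<sigma> ` lq_ball q) \<le> (1 + \<eta> * \<sigma> powr p) * \<beta>"
    if \<sigma>: "0 < \<sigma>" "\<sigma> < \<sigma>0" for \<sigma>
  proof -
    define l where "l = 1 + C * \<sigma>\<^sup>2"
    have l: "l \<ge> 1"
      using C by (simp add: l_def)
    have "\<sigma> \<le> sqrt (1 / C)"
      using \<sigma> by (simp add: \<sigma>0_def)
    then have "\<sigma>\<^sup>2 \<le> 1 / C"
      using \<sigma> C real_le_rsqrt sqrt_le_D by (metis real_sqrt_le_iff real_sqrt_abs abs_of_pos)
    then have C1: "C * \<sigma>\<^sup>2 \<le> 1"
      using C by (simp add: field_simps)
    have "\<sigma> powr (2 - p) \<le> (A powr (1 / (2 - p))) powr (2 - p)"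
      using \<sigma> p2 by (intro powr_mono2) (auto simp: \<sigma>0_def)
    also have "\<dots> = A"
      using A p2 by (simp add: powr_powr)
    finally have "\<sigma> powr (2 - p) * \<sigma> powr p \<le> A * \<sigma> powr p"
      by (intro mult_right_mono) auto
    moreover have "\<sigma> powr (2 - p) * \<sigma> powr p = \<sigma>\<^sup>2"
      using \<sigma> by (simp flip: powr_add)
    ultimately have \<sigma>A: "\<sigma>\<^sup>2 \<le> A * \<sigma> powr p"
      by simp
    have "l ^ ?n \<le> 1 + 3 ^ ?n * (C * \<sigma>\<^sup>2)"
      unfolding l_def using C C1 by (intro one_plus_power_le) auto
    also have "\<dots> \<le> 1 + 3 ^ ?n * (C * (A * \<sigma> powr p))"
      using C \<sigma>A by (intro add_left_mono mult_left_mono) auto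
    also have "\<dots> = 1 + \<eta> / 2 * \<sigma> powr p"
      using C by (simp add: A_def)
    finally have ln: "l ^ ?n \<le> 1 + \<eta> / 2 * \<sigma> powr p" .
    define W where "W = ?B \<inter> {x. \<bar>x $ k\<bar> \<le> h}"
    let ?S = "stretch (\<lambda>i :: 'n. if i = j then 1 + 2 * \<sigma> powr p else 1)"
    have B: "?B \<in> lmeasurable"
      using q_gt_1 by (intro lmeasurable_compact compact_lq_ball) auto
    have W: "W \<in> lmeasurable"
      unfolding W_def using q_gt_1
      by (intro lmeasurable_compact compact_slab) auto
    have scale: "(*\<^sub>R) l ` S \<in> lmeasurable" "measure lebesgue ((*\<^sub>R) l ` S) = l ^ ?n * measure lebesgue S"
      if "S \<in> lmeasurable" for S :: "(real^'n) set"
    proof -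
      have eq: "(*\<^sub>R) l = (stretch (\<lambda>_. l) :: real^'n \<Rightarrow> real^'n)"
        by (auto simp: stretch_def vec_eq_iff)
      show "(*\<^sub>R) l ` S \<in> lmeasurable" "measure lebesgue ((*\<^sub>R) l ` S) = l ^ ?n * measure lebesgue S"
        unfolding eq using l measure_stretch_image[OF that, of "\<lambda>_. l"] by simp_all
    qed
    have S: "?S ` W \<in> lmeasurable" "measure lebesgue (?S ` W) = (1 + 2 * \<sigma> powr p) * measure lebesgue W"
      using measure_stretch_image[OF W, of "\<lambda>i. if i = j then 1 + 2 * \<sigma> powr p else 1"]
      by (simp_all add: prod.delta)
    have WB: "W \<subseteq> (*\<^sub>R) l ` ?B"
    proof
      fix x assume "x \<in> W"
      then have "(\<Sum>i\<in>UNIV. \<bar>x $ i\<bar> powr q) \<le> 1"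
        by (simp add: W_def lq_ball_def)
      also have "1 \<le> l powr q"
        using l q_gt_1 by (intro ge_one_powr_ge_zero) auto
      finally show "x \<in> (*\<^sub>R) l ` ?B"
        using l by (subst scaled_lq_ball_iff) auto
    qed
    have cover: "balanced_map p j k \<sigma> ` lq_ball q \<subseteq> ((*\<^sub>R) l ` ?B - W) \<union> ?S ` W"
    proof
      fix z assume "z \<in> balanced_map p j k \<sigma> ` lq_ball q"
      then obtain c where c: "c \<in> lq_ball q" "z = balanced_map p j k \<sigma> c"
        by blast
      show "z \<in> ((*\<^sub>R) l ` ?B - W) \<union> ?S ` W"
      proof (cases "\<bar>z $ k\<bar> \<le> h")
        case True
        obtain x where x: "x \<in> ?B" "z = ?S x"
          using balanced_map_inner[OF jk \<sigma>(1) q2 c(1)] c(2) by blast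
        then have "z $ k = x $ k"
          using jk by (simp add: stretch_def)
        then show ?thesis
          using True x by (auto simp: W_def)
      next
        case False
        have "\<bar>z $ k\<bar> = \<bar>(c $ Some k + c $ None) / 2\<bar> * 2 / 2 powr (1 / p)"
          using jk by (simp add: c(2) balanced_map_def)
        with False have "\<delta> \<le> \<bar>(c $ Some k + c $ None) / 2\<bar>"
          by (simp add: \<delta>_def field_simps)
        then show ?thesis
          using balanced_map_outer[OF jk \<sigma>(1) q2 c(1) \<delta>] False c(2)
          by (simp add: W_def l_def C_def)
      qed
    qed
    have "measure lebesgue (balanced_map p j k \<sigma> ` lq_ball q)
        \<le> measure lebesgue (((*\<^sub>R) l ` ?B - W) \<union> ?S ` W)"
    proof (rule measure_mono_fmeasurable[OF cover])
      show "balanced_map p j k \<sigma> ` lq_ball q \<in> sets lebesgue"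
        using q_gt_1 linear_balanced_map
        by (intro fmeasurableD lmeasurable_compact compact_continuous_image linear_continuous_on compact_lq_ball)
          (auto simp flip: linear_conv_bounded_linear)
      show "((*\<^sub>R) l ` ?B - W) \<union> ?S ` W \<in> lmeasurable"
        using scale(1)[OF B] W S(1) by (intro fmeasurable.Un fmeasurable.Diff) auto
    qed
    also have "\<dots> \<le> measure lebesgue ((*\<^sub>R) l ` ?B - W) + measure lebesgue (?S ` W)"
      using scale(1)[OF B] W S(1) by (intro measure_Un_le) auto
    also have "measure lebesgue ((*\<^sub>R) l ` ?B - W) = l ^ ?n * \<beta> - measure lebesgue W"
      using scale[OF B] W WB by (subst measurable_measure_Diff) (auto simp: \<beta>_def)
    also have "l ^ ?n * \<beta> - measure lebesgue W + measure lebesgue (?S ` W)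
        = l ^ ?n * \<beta> + 2 * \<sigma> powr p * measure lebesgue W"
      unfolding S(2) by (simp add: algebra_simps)
    also have "\<dots> \<le> (1 + \<eta> / 2 * \<sigma> powr p) * \<beta> + 2 * \<sigma> powr p * (2 ^ ?n * h)"
      using ln \<beta> measure_slab_le[of q h k] q_gt_1 h
      by (intro add_mono mult_right_mono mult_left_mono) (auto simp: W_def)
    also have "\<dots> = (1 + \<eta> * \<sigma> powr p) * \<beta>"
      by (simp add: h_def algebra_simps)
    finally show ?thesis .
  qed
  ultimately show ?thesis
    unfolding \<beta>_def by blast
qed

section \<open>Volumes of images and projections of zonotopes\<close>

lemma compact_linear_image_euclidean:
  fixes f :: "'a::euclidean_space \<Rightarrow> 'b::real_normed_vector"
  shows "linear f \<Longrightarrow> compact S \<Longrightarrow> compact (f ` S)"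
  by (intro compact_continuous_image linear_continuous_on) (simp_all add: linear_conv_bounded_linear)

lemma vol_eq_lebesgue: "compact S \<Longrightarrow> vol S = measure lebesgue S"
  by (simp add: vol_def borel_compact)

lemma linear_image_lq_zonotope:
  assumes "linear f"
  shows "f ` lq_zonotope q v = lq_zonotope q (\<lambda>i. f (v i))"
  using assms by (simp add: lq_zonotope_def image_image linear_sum linear_scale)

lemma linear_image_unit_cylinder:
  assumes "linear f"
  shows "f ` unit_cylinder u Y = unit_cylinder (f u) (f ` Y)"
proof -
  have "f ` unit_cylinder u Y = (\<lambda>(y, r). y + r *\<^sub>R f u) ` (\<lambda>(y, r). (f y, r)) ` (Y \<times> {0..1})"
    by (simp add: unit_cylinder_def image_image case_prod_beta linear_add[OF assms] linear_scale[OF assms])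
  also have "(\<lambda>(y, r). (f y, r)) ` (Y \<times> {0..1}) = f ` Y \<times> {0..1 :: real}"
    by force
  finally show ?thesis
    by (simp add: unit_cylinder_def)
qed

lemma linear_proj_perp: "linear (proj_perp u)"
  by (rule linearI) (simp_all add: proj_perp_def inner_add_right add_divide_distrib scaleR_add_left
      scaleR_diff_right)

lemma vol_stretch: "compact S \<Longrightarrow> vol (stretch m ` S) = \<bar>prod m UNIV\<bar> * vol S"
  using compact_linear_image_euclidean[OF linear_stretch, of S m]
  by (simp add: vol_eq_lebesgue measure_stretch_image lmeasurable_compact)

lemma vol_shear:
  assumes "compact S" "j \<noteq> k"
  shows "vol (shear j k c ` S) = vol S"
  using compact_linear_image_euclidean[OF linear_shear, of S j k c] assms
  by (simp add: vol_eq_lebesgue measure_shear_image lmeasurable_compact)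

lemma sum_axis: "(\<Sum>i\<in>UNIV. c $ i *\<^sub>R axis i 1) = (c :: real^'i)"
  by (simp add: vec_eq_iff axis_def if_distrib[of "\<lambda>x. _ * x"] cong: if_cong)

lemma lq_ball_eq_zonotope: "(lq_ball q :: (real^'i) set) = lq_zonotope q (\<lambda>i. axis i (1 :: real))"
  by (simp add: lq_zonotope_def sum_axis)

definition cross_section :: "real \<Rightarrow> 'n \<Rightarrow> (real^'n) set" where
  "cross_section q k = lq_zonotope q (\<lambda>i. if i = k then 0 else axis i 1)"

lemma vol_cross_section_cylinder_pos:
  fixes k :: "'n::finite"
  assumes q: "q > 0"
  shows "vol (unit_cylinder (axis k 1) (cross_section q k)) > 0"
proof -
  define r where "r = (1 / real CARD('n)) powr (1 / q)"
  have r: "r > 0"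
    by (simp add: r_def)
  define a b :: "real^'n" where "a = (\<chi> i. if i = k then 0 else - r)" and "b = (\<chi> i. if i = k then 1 else r)"
  have ne: "cbox a b \<noteq> {}"
    using r by (simp add: interval_ne_empty_cart a_def b_def)
  have "cbox a b \<subseteq> unit_cylinder (axis k 1) (cross_section q k)"
  proof
    fix x assume x: "x \<in> cbox a b"
    define c where "c = (\<chi> i. if i = k then 0 else x $ i)"
    have "- r \<le> c $ i \<and> c $ i \<le> r" for i
      using x r by (cases "i = k") (auto simp: mem_box_cart a_def b_def c_def dest: spec[of _ i])
    then have "c \<in> cbox (\<chi> i. - r) (\<chi> i. r)"
      by (simp add: mem_box_cart)
    then have "c \<in> lq_ball q"
      using cube_subset_lq_ball[OF q] by (auto simp: r_def)
    moreover have "c = (\<Sum>i\<in>UNIV. c $ i *\<^sub>R (if i = k then 0 else axis i 1))"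
    proof -
      have "(\<Sum>i\<in>UNIV. c $ i *\<^sub>R (if i = k then 0 else axis i 1)) = (\<Sum>i\<in>UNIV. c $ i *\<^sub>R axis i 1)"
        by (intro sum.cong) (simp_all add: c_def)
      also have "\<dots> = c"
        by (rule sum_axis)
      finally show ?thesis
        by (rule sym)
    qed
    ultimately have "c \<in> cross_section q k"
      unfolding cross_section_def lq_zonotope_def by blast
    moreover have "x = c + x $ k *\<^sub>R axis k 1"
      by (simp add: vec_eq_iff axis_def c_def)
    moreover have "x $ k \<in> {0..1}"
      using x by (auto simp: mem_box_cart a_def b_def dest: spec[of _ k])
    ultimately show "x \<in> unit_cylinder (axis k 1) (cross_section q k)"
      unfolding mem_unit_cylinder by blast
  qed
  moreover have C: "compact (unit_cylinder (axis k 1) (cross_section q k))"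
    unfolding cross_section_def by (intro compact_unit_cylinder compact_lq_zonotope q)
  ultimately have "measure lebesgue (cbox a b) \<le> vol (unit_cylinder (axis k 1) (cross_section q k))"
    unfolding vol_eq_lebesgue[OF C]
    by (intro measure_mono_fmeasurable lmeasurable_compact) auto
  moreover have "measure lebesgue (cbox a b) = (\<Prod>i\<in>UNIV. b $ i - a $ i)"
    by (simp add: content_cbox_cart[OF ne])
  moreover have "(\<Prod>i\<in>UNIV. b $ i - a $ i) > 0"
    using r by (intro prod_pos) (simp add: a_def b_def)
  ultimately show ?thesis
    by linarith
qed

context conjugate_exponents
begin

text \<open>If the projection has the support function of a zonotope with generators along the axes, it is a
  stretched copy of the cross section of the \<open>l\<^sub>q\<close> ball, and the cylinder over it a stretched copy of
  the cylinder over the cross section. The volume of the latter is a common factor of all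
  projections below and cancels in the end.\<close>

lemma proj_vol_lq_zonotope:
  fixes v :: "'i::finite \<Rightarrow> real^'n" and k :: 'n
  assumes t: "\<And>i. t i \<ge> 0"
    and supp: "\<And>x. (\<Sum>i\<in>UNIV. \<bar>x \<bullet> proj_perp (axis k 1) (v i)\<bar> powr p) = (\<Sum>i\<in>UNIV - {k}. t i * \<bar>x $ i\<bar> powr p)"
  shows "proj_vol (axis k 1) (lq_zonotope q v)
    = (\<Prod>i\<in>UNIV - {k}. t i powr (1 / p)) * vol (unit_cylinder (axis k 1) (cross_section q k))"
proof -
  define m where "m i = (if i = k then 1 else t i powr (1 / p))" for i
  have m: "m i \<ge> 0" for i
    by (simp add: m_def)
  have Q: "compact (unit_cylinder (axis k 1) (cross_section q k))"
    unfolding cross_section_def using q_gt_1 by (intro compact_unit_cylinder compact_lq_zonotope) simp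
  have "lq_zonotope q (\<lambda>i. proj_perp (axis k 1) (v i)) = lq_zonotope q (\<lambda>i. stretch m (if i = k then 0 else axis i 1))"
  proof (rule lq_zonotope_eqI)
    fix x :: "real^'n"
    have "(\<Sum>i\<in>UNIV. \<bar>x \<bullet> stretch m (if i = k then 0 else axis i 1)\<bar> powr p)
        = (\<Sum>i\<in>UNIV. if i = k then 0 else t i * \<bar>x $ i\<bar> powr p)"
    proof (intro sum.cong refl)
      fix i
      have "\<bar>t i powr (1 / p) * x $ i\<bar> powr p = t i * \<bar>x $ i\<bar> powr p"
        using t[of i] p_gt_1 by (simp add: abs_mult powr_mult powr_powr)
      then show "\<bar>x \<bullet> stretch m (if i = k then 0 else axis i 1)\<bar> powr p = (if i = k then 0 else t i * \<bar>x $ i\<bar> powr p)"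
        by (cases "i = k") (simp_all add: stretch_0 stretch_axis m_def inner_axis)
    qed
    also have "\<dots> = (\<Sum>i\<in>UNIV - {k}. t i * \<bar>x $ i\<bar> powr p)"
      by (simp add: sum.remove[of UNIV k])
    finally show "(\<Sum>i\<in>UNIV. \<bar>x \<bullet> proj_perp (axis k 1) (v i)\<bar> powr p)
        = (\<Sum>i\<in>UNIV. \<bar>x \<bullet> stretch m (if i = k then 0 else axis i 1)\<bar> powr p)"
      by (simp add: supp)
  qed
  then have "proj_perp (axis k 1) ` lq_zonotope q v = stretch m ` cross_section q k"
    by (simp add: linear_image_lq_zonotope linear_proj_perp linear_stretch cross_section_def)
  then have "proj_vol (axis k 1) (lq_zonotope q v) = vol (unit_cylinder (axis k 1) (stretch m ` cross_section q k))"
    using q_gt_1 by (subst proj_vol_eq_vol_cylinder) (simp_all add: compact_lq_zonotope)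
  also have "unit_cylinder (axis k 1) (stretch m ` cross_section q k)
      = stretch m ` unit_cylinder (axis k 1) (cross_section q k)"
    by (simp add: linear_image_unit_cylinder linear_stretch stretch_axis m_def)
  also have "vol \<dots> = \<bar>prod m UNIV\<bar> * vol (unit_cylinder (axis k 1) (cross_section q k))"
    by (rule vol_stretch[OF Q])
  also have "\<bar>prod m UNIV\<bar> = prod m UNIV"
    using m by (simp add: prod_nonneg)
  also have "prod m UNIV = m k * prod m (UNIV - {k})"
    by (rule prod.remove) auto
  also have "prod m (UNIV - {k}) = (\<Prod>i\<in>UNIV - {k}. t i powr (1 / p))"
    by (intro prod.cong) (auto simp: m_def)
  finally show ?thesis
    by (simp add: m_def)
qed

end

section \<open>The counterexample\<close>

context conjugate_exponents
begin

context
  fixes j k :: "'n::finite" and s :: real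
  assumes jk: "j \<noteq> k" and s: "s > 0"
begin

definition A_vec :: "'n \<Rightarrow> real^'n" where
  "A_vec i = (if i = k then axis k 1 + s *\<^sub>R axis j 1 else (3 / 4) powr (1 / p) *\<^sub>R axis i 1)"

definition B_vec :: "'n \<Rightarrow> real^'n" where
  "B_vec i = (if i = k then axis k 1 else (1 / 4) powr (1 / p) *\<^sub>R axis i 1)"

definition sum_vec :: "'n option \<Rightarrow> real^'n" where
  "sum_vec = case_option (axis k 1) (\<lambda>i. axis i 1 + (if i = k then s *\<^sub>R axis j 1 else 0))"

lemma sum_remove_k: "(\<Sum>i\<in>UNIV. f i) = f k + (\<Sum>i\<in>UNIV - {k}. f i)" for f :: "'n \<Rightarrow> real"
  by (rule sum.remove) auto

lemma abs_powr_scaled: "t \<ge> 0 \<Longrightarrow> \<bar>t powr (1 / p) * y\<bar> powr p = t * \<bar>y\<bar> powr p"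
  using p_gt_1 by (simp add: abs_mult powr_mult powr_powr)

text \<open>The weights \<open>3/4\<close> and \<open>1/4\<close> of the parallel generators add up to \<open>1\<close>, while \<open>e\<^sub>k\<close> and \<open>e\<^sub>k + s e\<^sub>j\<close> remain
  separate generators.\<close>

lemma Lp_sum_A_B:
  "Lp_sum p (lq_zonotope q A_vec) (lq_zonotope q B_vec) = lq_zonotope q sum_vec"
proof (rule Lp_sum_lq_zonotope)
  fix x :: "real^'n"
  have A: "\<bar>x \<bullet> A_vec i\<bar> powr p = 3 / 4 * \<bar>x $ i\<bar> powr p" if "i \<noteq> k" for i
    using that abs_powr_scaled[of "3 / 4" "x $ i"] by (simp add: A_vec_def inner_axis)
  have B: "\<bar>x \<bullet> B_vec i\<bar> powr p = 1 / 4 * \<bar>x $ i\<bar> powr p" if "i \<noteq> k" for i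
    using that abs_powr_scaled[of "1 / 4" "x $ i"] by (simp add: B_vec_def inner_axis)
  have AB: "(\<Sum>i\<in>UNIV - {k}. \<bar>x \<bullet> A_vec i\<bar> powr p) + (\<Sum>i\<in>UNIV - {k}. \<bar>x \<bullet> B_vec i\<bar> powr p)
      = (\<Sum>i\<in>UNIV - {k}. \<bar>x \<bullet> sum_vec (Some i)\<bar> powr p)"
    unfolding sum.distrib[symmetric] by (intro sum.cong) (simp_all add: A B sum_vec_def inner_axis)
  have "\<bar>x \<bullet> sum_vec None\<bar> powr p = \<bar>x \<bullet> B_vec k\<bar> powr p"
    "\<bar>x \<bullet> sum_vec (Some k)\<bar> powr p = \<bar>x \<bullet> A_vec k\<bar> powr p"
    by (simp_all add: sum_vec_def A_vec_def B_vec_def)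
  then show "(\<Sum>i\<in>UNIV. \<bar>x \<bullet> sum_vec i\<bar> powr p)
      = (\<Sum>i\<in>UNIV. \<bar>x \<bullet> A_vec i\<bar> powr p) + (\<Sum>i\<in>UNIV. \<bar>x \<bullet> B_vec i\<bar> powr p)"
    using AB by (simp add: sum_UNIV_option sum_remove_k)
qed

lemma prod_if_k:
  fixes a :: real
  shows "(\<Prod>i\<in>UNIV. if i = k then 1 else a) = (\<Prod>i\<in>UNIV - {k}. a)"
proof -
  have "(\<Prod>i\<in>UNIV. if i = k then 1 else a) = (if k = k then 1 else a) * (\<Prod>i\<in>UNIV - {k}. if i = k then 1 else a)"
    by (rule prod.remove) auto
  also have "(\<Prod>i\<in>UNIV - {k}. if i = k then 1 else a) = (\<Prod>i\<in>UNIV - {k}. a)"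
    by (intro prod.cong) auto
  finally show ?thesis by simp
qed

lemma vol_diagonal:
  fixes a :: real
  assumes "a \<ge> 0"
  shows "vol (lq_zonotope q (\<lambda>i. (if i = k then 1 else a) *\<^sub>R axis i (1 :: real)))
    = (\<Prod>i\<in>UNIV - {k}. a) * vol (lq_ball q :: (real^'n) set)"
proof -
  have "lq_zonotope q (\<lambda>i. (if i = k then 1 else a) *\<^sub>R axis i (1 :: real))
      = stretch (\<lambda>i. if i = k then 1 else a) ` lq_ball q"
    by (simp add: lq_ball_eq_zonotope linear_image_lq_zonotope[OF linear_stretch] stretch_axis)
  then have "vol (lq_zonotope q (\<lambda>i. (if i = k then 1 else a) *\<^sub>R axis i (1 :: real)))
      = \<bar>\<Prod>i\<in>UNIV. if i = k then 1 else a\<bar> * vol (lq_ball q :: (real^'n) set)"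
    using q_gt_1 by (simp add: vol_stretch[OF compact_lq_ball])
  also have "\<bar>\<Prod>i\<in>UNIV. if i = k then 1 else a\<bar> = (\<Prod>i\<in>UNIV - {k}. a)"
    unfolding prod_if_k using assms by (intro abs_of_nonneg prod_nonneg) auto
  finally show ?thesis .
qed

lemma vol_A: "vol (lq_zonotope q A_vec)
    = (\<Prod>i\<in>UNIV - {k}. (3 / 4) powr (1 / p)) * vol (lq_ball q :: (real^'n) set)"
proof -
  have "A_vec = (\<lambda>i. shear j k s ((if i = k then 1 else (3 / 4) powr (1 / p)) *\<^sub>R axis i 1))"
    by (auto simp: fun_eq_iff A_vec_def shear_def vec_eq_iff axis_def)
  then have "lq_zonotope q A_vec
      = shear j k s ` lq_zonotope q (\<lambda>i. (if i = k then 1 else (3 / 4) powr (1 / p)) *\<^sub>R axis i 1)"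
    by (simp add: linear_image_lq_zonotope[OF linear_shear])
  then show ?thesis
    using jk q_gt_1 by (simp add: vol_shear compact_lq_zonotope vol_diagonal)
qed

lemma vol_B: "vol (lq_zonotope q B_vec)
    = (\<Prod>i\<in>UNIV - {k}. (1 / 4) powr (1 / p)) * vol (lq_ball q :: (real^'n) set)"
proof -
  have "B_vec = (\<lambda>i. (if i = k then 1 else (1 / 4) powr (1 / p)) *\<^sub>R axis i 1)"
    by (auto simp: fun_eq_iff B_vec_def)
  then show ?thesis
    by (simp add: vol_diagonal)
qed

text \<open>The shear by \<open>-s/2\<close> makes the two generators near \<open>e\<^sub>k\<close> symmetric to each other.\<close>

lemma vol_sum: "vol (lq_zonotope q sum_vec)
    = 2 powr (1 / p) * vol (balanced_map p j k (s / 2) ` lq_ball q)"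
proof -
  let ?m = "\<lambda>i. if i = k then 2 powr (1 / p) else 1"
  have "shear j k (- (s / 2)) (\<Sum>i\<in>UNIV. c $ i *\<^sub>R sum_vec i) = stretch ?m (balanced_map p j k (s / 2) c)" for c
  proof -
    have "(\<Sum>i\<in>UNIV. c $ Some i *\<^sub>R sum_vec (Some i))
        = (\<Sum>i\<in>UNIV. c $ Some i *\<^sub>R axis i 1 + (if i = k then c $ Some k *\<^sub>R s *\<^sub>R axis j 1 else 0))"
      by (intro sum.cong) (simp_all add: sum_vec_def scaleR_add_right)
    also have "\<dots> = (\<Sum>i\<in>UNIV. (\<chi> i. c $ Some i) $ i *\<^sub>R axis i 1) + c $ Some k *\<^sub>R s *\<^sub>R axis j 1"
      by (simp add: sum.distrib)
    also have "\<dots> = (\<chi> i. c $ Some i) + c $ Some k *\<^sub>R s *\<^sub>R axis j 1"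
      by (simp only: sum_axis)
    finally have "(\<Sum>i\<in>UNIV. c $ i *\<^sub>R sum_vec i)
        = c $ None *\<^sub>R axis k 1 + ((\<chi> i. c $ Some i) + c $ Some k *\<^sub>R s *\<^sub>R axis j 1)"
      by (simp add: sum_UNIV_option) (simp add: sum_vec_def)
    then show ?thesis
      using jk by (auto simp: shear_def stretch_def balanced_map_def vec_eq_iff axis_def field_simps)
  qed
  then have "shear j k (- (s / 2)) ` lq_zonotope q sum_vec = stretch ?m ` balanced_map p j k (s / 2) ` lq_ball q"
    by (simp add: lq_zonotope_def image_image)
  moreover have "compact (balanced_map p j k (s / 2) ` lq_ball q)"
    using q_gt_1 by (intro compact_linear_image_euclidean linear_balanced_map compact_lq_ball) auto
  ultimately show ?thesis
    using vol_shear[of "lq_zonotope q sum_vec" j k "- (s / 2)"] jk q_gt_1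
    by (simp add: compact_lq_zonotope vol_stretch prod.delta)
qed

lemma inner_proj_perp_axis: "x \<bullet> proj_perp (axis k 1) v = x \<bullet> v - x $ k * v $ k" for x v :: "real^'n"
  by (simp add: proj_perp_def inner_diff_right inner_axis inner_axis')

lemma prod_remove_j: "(\<Prod>i\<in>UNIV - {k}. f i) = f j * (\<Prod>i\<in>UNIV - {k} - {j}. f i)" for f :: "'n \<Rightarrow> real"
  using jk by (intro prod.remove) auto

lemma sum_remove_j: "(\<Sum>i\<in>UNIV - {k}. f i) = f j + (\<Sum>i\<in>UNIV - {k} - {j}. f i)" for f :: "'n \<Rightarrow> real"
  using jk by (intro sum.remove) auto

lemma proj_vol_A: "proj_vol (axis k 1) (lq_zonotope q A_vec)
  = (3 / 4 + s powr p) powr (1 / p) * (\<Prod>i\<in>UNIV - {k} - {j}. (3 / 4) powr (1 / p))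
    * vol (unit_cylinder (axis k 1) (cross_section q k))"
proof -
  have "proj_vol (axis k 1) (lq_zonotope q A_vec)
    = (\<Prod>i\<in>UNIV - {k}. (if i = j then 3 / 4 + s powr p else 3 / 4) powr (1 / p))
      * vol (unit_cylinder (axis k 1) (cross_section q k))"
  proof (rule proj_vol_lq_zonotope)
    fix x :: "real^'n"
    have "\<bar>x \<bullet> proj_perp (axis k 1) (A_vec i)\<bar> powr p = 3 / 4 * \<bar>x $ i\<bar> powr p" if "i \<noteq> k" for i
      using that abs_powr_scaled[of "3 / 4" "x $ i"]
      by (simp add: inner_proj_perp_axis A_vec_def inner_axis) (simp add: axis_def)
    then have "(\<Sum>i\<in>UNIV - {k}. \<bar>x \<bullet> proj_perp (axis k 1) (A_vec i)\<bar> powr p)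
        = (\<Sum>i\<in>UNIV - {k}. 3 / 4 * \<bar>x $ i\<bar> powr p)"
      by (intro sum.cong) auto
    moreover have "\<bar>x \<bullet> proj_perp (axis k 1) (A_vec k)\<bar> powr p = s powr p * \<bar>x $ j\<bar> powr p"
      using jk s by (simp add: inner_proj_perp_axis A_vec_def inner_axis inner_add_right abs_mult powr_mult)
        (simp add: axis_def abs_mult powr_mult)
    ultimately show "(\<Sum>i\<in>UNIV. \<bar>x \<bullet> proj_perp (axis k 1) (A_vec i)\<bar> powr p)
        = (\<Sum>i\<in>UNIV - {k}. (if i = j then 3 / 4 + s powr p else 3 / 4) * \<bar>x $ i\<bar> powr p)"
      using jk by (simp add: sum_remove_k sum_remove_j algebra_simps)
  qed (simp add: add_nonneg_nonneg)
  then show ?thesis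
    by (simp add: prod_remove_j)
qed

lemma proj_vol_B: "proj_vol (axis k 1) (lq_zonotope q B_vec)
  = (\<Prod>i\<in>UNIV - {k}. (1 / 4) powr (1 / p)) * vol (unit_cylinder (axis k 1) (cross_section q k))"
proof (rule proj_vol_lq_zonotope)
  fix x :: "real^'n"
  have "\<bar>x \<bullet> proj_perp (axis k 1) (B_vec i)\<bar> powr p = 1 / 4 * \<bar>x $ i\<bar> powr p" if "i \<noteq> k" for i
    using that abs_powr_scaled[of "1 / 4" "x $ i"]
    by (simp add: inner_proj_perp_axis B_vec_def inner_axis) (simp add: axis_def)
  then have "(\<Sum>i\<in>UNIV - {k}. \<bar>x \<bullet> proj_perp (axis k 1) (B_vec i)\<bar> powr p)
      = (\<Sum>i\<in>UNIV - {k}. 1 / 4 * \<bar>x $ i\<bar> powr p)"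
    by (intro sum.cong) auto
  moreover have "x \<bullet> proj_perp (axis k 1) (B_vec k) = 0"
    by (simp add: inner_proj_perp_axis B_vec_def inner_axis)
  ultimately show "(\<Sum>i\<in>UNIV. \<bar>x \<bullet> proj_perp (axis k 1) (B_vec i)\<bar> powr p)
      = (\<Sum>i\<in>UNIV - {k}. 1 / 4 * \<bar>x $ i\<bar> powr p)"
    by (simp add: sum_remove_k)
qed simp

lemma proj_vol_sum: "proj_vol (axis k 1) (lq_zonotope q sum_vec)
  = (1 + s powr p) powr (1 / p) * vol (unit_cylinder (axis k 1) (cross_section q k))"
proof -
  have "proj_vol (axis k 1) (lq_zonotope q sum_vec)
    = (\<Prod>i\<in>UNIV - {k}. (if i = j then 1 + s powr p else 1) powr (1 / p))
      * vol (unit_cylinder (axis k 1) (cross_section q k))"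
  proof (rule proj_vol_lq_zonotope)
    fix x :: "real^'n"
    have "x \<bullet> proj_perp (axis k 1) (sum_vec (Some i)) = x $ i" if "i \<noteq> k" for i
      using that by (simp add: inner_proj_perp_axis sum_vec_def inner_axis) (simp add: axis_def)
    then have "(\<Sum>i\<in>UNIV - {k}. \<bar>x \<bullet> proj_perp (axis k 1) (sum_vec (Some i))\<bar> powr p)
        = (\<Sum>i\<in>UNIV - {k}. \<bar>x $ i\<bar> powr p)"
      by (intro sum.cong) auto
    moreover have "\<bar>x \<bullet> proj_perp (axis k 1) (sum_vec (Some k))\<bar> powr p = s powr p * \<bar>x $ j\<bar> powr p"
      using jk s by (simp add: inner_proj_perp_axis sum_vec_def inner_axis inner_add_right abs_mult powr_mult)
        (simp add: axis_def abs_mult powr_mult)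
    moreover have "x \<bullet> proj_perp (axis k 1) (sum_vec None) = 0"
      by (simp add: inner_proj_perp_axis sum_vec_def inner_axis)
    ultimately show "(\<Sum>i\<in>UNIV. \<bar>x \<bullet> proj_perp (axis k 1) (sum_vec i)\<bar> powr p)
        = (\<Sum>i\<in>UNIV - {k}. (if i = j then 1 + s powr p else 1) * \<bar>x $ i\<bar> powr p)"
      using jk by (simp add: sum_UNIV_option sum_remove_k sum_remove_j algebra_simps)
  qed (simp add: add_nonneg_nonneg)
  then show ?thesis
    by (simp add: prod_remove_j)
qed

end

end

text \<open>Here \<open>\<theta> = s\<^sup>p\<close>, and \<open>1 + \<theta> / 10\<close> bounds the volume factor \<open>V\<close>. To first order the sides are
  \<open>2 - (8/5) \<theta>\<close> and \<open>2 - (4/3) \<theta>\<close>.\<close>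

lemma final_numeric_inequality:
  fixes \<theta> :: real
  assumes "0 < \<theta>" "\<theta> \<le> 1"
  shows "2 * (1 + \<theta> / 10)\<^sup>2 / (1 + \<theta>) < (3 / 4) / (3 / 4 + \<theta>) + 1"
proof -
  have "(3 / 2 + \<theta>) * (1 + \<theta>) - 2 * (1 + \<theta> / 10)\<^sup>2 * (3 / 4 + \<theta>)
      = \<theta> / 5 + \<theta>\<^sup>2 * (117 / 200 - \<theta> / 50)"
    by (simp add: power2_eq_square field_simps)
  moreover have "0 \<le> \<theta>\<^sup>2 * (117 / 200 - \<theta> / 50)"
    using assms by (intro mult_nonneg_nonneg) auto
  ultimately have less: "2 * (1 + \<theta> / 10)\<^sup>2 * (3 / 4 + \<theta>) < (3 / 2 + \<theta>) * (1 + \<theta>)"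
    using assms by linarith
  have "2 * (1 + \<theta> / 10)\<^sup>2 / (1 + \<theta>) < (3 / 2 + \<theta>) / (3 / 4 + \<theta>)"
  proof -
    have "0 < 1 + \<theta>" "0 < 3 / 4 + \<theta>"
      using assms by auto
    with less show ?thesis
      by (simp only: pos_divide_less_eq times_divide_eq_left pos_less_divide_eq)
  qed
  also have "(3 / 2 + \<theta>) / (3 / 4 + \<theta>) = (3 / 4) / (3 / 4 + \<theta>) + 1"
    using assms by (simp add: field_simps)
  finally show ?thesis .
qed

theorem theorem1:
  fixes p :: real
  assumes "1 < p" and "p < 2"
    and "CARD('n::finite) \<ge> 2"
  shows "\<exists>(A :: (real ^ 'n) set) B u.
    Lp_zonotope p A \<and> Lp_zonotope p B \<and> norm u = 1 \<and>
    proj_vol u A > 0 \<and> proj_vol u B > 0 \<and> proj_vol u (Lp_sum p A B) > 0 \<and>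
    (vol (Lp_sum p A B) / proj_vol u (Lp_sum p A B)) powr p
      < (vol A / proj_vol u A) powr p + (vol B / proj_vol u B) powr p"
proof -
  define q where "q = p / (p - 1)"
  interpret conjugate_exponents p q
    using assms by unfold_locales (auto simp: q_def field_simps)
  have "\<not> CARD('n) \<le> Suc 0"
    using assms(3) by simp
  then obtain j k :: 'n where jk: "j \<noteq> k"
    using card_le_Suc0_iff_eq[of "UNIV :: 'n set"] by auto
  define \<beta> where "\<beta> = vol (lq_ball q :: (real^'n) set)"
  define \<gamma> where "\<gamma> = vol (unit_cylinder (axis k 1) (cross_section q k))"
  have \<beta>: "\<beta> > 0"
    unfolding \<beta>_def using q_gt_1
    by (subst vol_eq_lebesgue) (simp_all add: compact_lq_ball measure_lq_ball_pos)
  have \<gamma>: "\<gamma> > 0"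
    unfolding \<gamma>_def using q_gt_1 by (intro vol_cross_section_cylinder_pos) simp
  obtain \<sigma>0 where \<sigma>0: "\<sigma>0 > 0" and bound: "\<And>\<sigma>. 0 < \<sigma> \<Longrightarrow> \<sigma> < \<sigma>0 \<Longrightarrow>
      measure lebesgue (balanced_map p j k \<sigma> ` lq_ball q)
        \<le> (1 + 1 / 10 * \<sigma> powr p) * measure lebesgue (lq_ball q :: (real^'n) set)"
    using measure_balanced_image_le[OF jk assms(2), of "1 / 10"] by auto
  define s where "s = min 1 \<sigma>0"
  have s: "0 < s" "s \<le> 1" "s / 2 < \<sigma>0"
    using \<sigma>0 by (auto simp: s_def)
  define \<theta> where "\<theta> = s powr p"
  have \<theta>: "0 < \<theta>" "\<theta> \<le> 1"
    using s assms by (auto simp: \<theta>_def powr_le1)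
  define R where "R = UNIV - {k} - {j}"
  define \<tau> where "\<tau> = (3 / 4 :: real) powr (1 / p)"
  have \<tau>: "\<tau> > 0"
    by (simp add: \<tau>_def)
  let ?A = "lq_zonotope q (A_vec j k s)" and ?B = "lq_zonotope q (B_vec k)"
    and ?S = "lq_zonotope q (sum_vec j k s)" and ?u = "axis k 1 :: real^'n"
  have S: "Lp_sum p ?A ?B = ?S"
    by (rule Lp_sum_A_B[OF jk s(1)])
  have pA: "proj_vol ?u ?A = (3 / 4 + \<theta>) powr (1 / p) * (\<Prod>i\<in>R. \<tau>) * \<gamma>"
    unfolding proj_vol_A[OF jk s(1)] \<theta>_def R_def \<tau>_def \<gamma>_def ..
  have pB: "proj_vol ?u ?B = (\<Prod>i\<in>UNIV - {k}. (1 / 4) powr (1 / p)) * \<gamma>"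
    unfolding proj_vol_B[OF jk s(1)] \<gamma>_def ..
  have pS: "proj_vol ?u ?S = (1 + \<theta>) powr (1 / p) * \<gamma>"
    unfolding proj_vol_sum[OF jk s(1)] \<theta>_def \<gamma>_def ..
  have pos: "proj_vol ?u ?A > 0" "proj_vol ?u ?B > 0" "proj_vol ?u ?S > 0"
    unfolding pA pB pS using \<theta> \<tau> \<gamma> by (auto intro!: mult_pos_pos prod_pos)
  have "vol ?A = \<tau> * (\<Prod>i\<in>R. \<tau>) * \<beta>"
    unfolding vol_A[OF jk s(1)] R_def \<tau>_def \<beta>_def prod_remove_j[OF jk s(1)] ..
  then have "vol ?A / proj_vol ?u ?A = \<tau> / (3 / 4 + \<theta>) powr (1 / p) * (\<beta> / \<gamma>)"
    using \<tau> \<gamma> unfolding pA by (simp add: prod_pos less_imp_neq[symmetric])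
  then have rA: "(vol ?A / proj_vol ?u ?A) powr p = (3 / 4) / (3 / 4 + \<theta>) * (\<beta> / \<gamma>) powr p"
    using assms(1) \<theta> by (simp add: powr_mult powr_divide powr_powr \<tau>_def)
  have rB: "(vol ?B / proj_vol ?u ?B) powr p = (\<beta> / \<gamma>) powr p"
    unfolding vol_B[OF jk s(1)] pB by (simp add: \<beta>_def)
  have "(s / 2) powr p \<le> \<theta>"
    unfolding \<theta>_def using s assms(1) by (intro powr_mono2) auto
  have "compact (balanced_map p j k (s / 2) ` lq_ball q)"
    using q_gt_1 by (intro compact_linear_image_euclidean linear_balanced_map compact_lq_ball) auto
  then have "vol (balanced_map p j k (s / 2) ` lq_ball q) \<le> (1 + 1 / 10 * (s / 2) powr p) * \<beta>"
    using bound[of "s / 2"] s q_gt_1 by (simp add: vol_eq_lebesgue \<beta>_def compact_lq_ball)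
  also have "\<dots> \<le> (1 + \<theta> / 10) * \<beta>"
    using \<open>(s / 2) powr p \<le> \<theta>\<close> \<beta> by (intro mult_right_mono) auto
  finally have "vol ?S \<le> 2 powr (1 / p) * ((1 + \<theta> / 10) * \<beta>)"
    unfolding vol_sum[OF jk s(1)] by (intro mult_left_mono) auto
  then have "vol ?S / proj_vol ?u ?S \<le> 2 powr (1 / p) * ((1 + \<theta> / 10) * \<beta>) / ((1 + \<theta>) powr (1 / p) * \<gamma>)"
    unfolding pS using \<theta> \<gamma> by (intro divide_right_mono) auto
  then have "(vol ?S / proj_vol ?u ?S) powr p
      \<le> (2 powr (1 / p) * ((1 + \<theta> / 10) * \<beta>) / ((1 + \<theta>) powr (1 / p) * \<gamma>)) powr p"
    using assms(1) pos(3) by (intro powr_mono2) (auto simp: vol_def)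
  also have "\<dots> = 2 * (1 + \<theta> / 10) powr p / (1 + \<theta>) * (\<beta> / \<gamma>) powr p"
    using assms(1) \<theta> by (simp add: powr_mult powr_divide powr_powr)
  also have "\<dots> \<le> 2 * (1 + \<theta> / 10)\<^sup>2 / (1 + \<theta>) * (\<beta> / \<gamma>) powr p"
  proof -
    have "(1 + \<theta> / 10) powr p \<le> (1 + \<theta> / 10) powr 2"
      using \<theta> assms(2) by (intro powr_mono) auto
    then show ?thesis
      using \<theta> by (intro mult_right_mono divide_right_mono mult_left_mono) auto
  qed
  also have "\<dots> < ((3 / 4) / (3 / 4 + \<theta>) + 1) * (\<beta> / \<gamma>) powr p"
    using final_numeric_inequality[OF \<theta>] \<beta> \<gamma> by (intro mult_strict_right_mono) auto
  also have "\<dots> = (vol ?A / proj_vol ?u ?A) powr p + (vol ?B / proj_vol ?u ?B) powr p"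
    unfolding rA rB by (simp add: algebra_simps)
  finally have main: "(vol ?S / proj_vol ?u ?S) powr p
      < (vol ?A / proj_vol ?u ?A) powr p + (vol ?B / proj_vol ?u ?B) powr p" .
  show ?thesis
    using main pos Lp_zonotope_lq_zonotope[of "A_vec j k s"] Lp_zonotope_lq_zonotope[of "B_vec k"]
    by (intro exI[of _ ?A] exI[of _ ?B] exI[of _ ?u]) (simp add: S norm_axis_1)
qed

end
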